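(* The number of $2n$-colorings of a link is an order $0$ $(n,q)$-finite invariant for any even $q$. Thus there are order $0$ $(n,q)$-finite invariants which are not of finite type.
   Context: All links are (tame, oriented) links in $S^3$, up to isotopy. Here $n\ge 1$ and $q\ge 0$ are integers. Colorings: for an integer $k\ge 1$, a $k$-coloring (Fox coloring) of a link diagram is an assignment of an element of $\mathbb{Z}/k\mathbb{Z}$ to each arc of the diagram such that at every crossing $2b=a+c$ in $\mathbb{Z}/k\mathbb{Z}$, where $b$ is the color of the overcrossing arc and $a,c$ are the colors of the two undercrossing arcs (constant colorings are allowed). The number of $k$-colorings does not depend on the diagram of the link, and is regarded as a $\mathbb{Z}$-valued link invariant. Finite type: a link invariant $f$ with values in an abelian group is of finite type of order $\le m$ if for each link diagram $D$ and every collection $(a_1,\dots,a_{m+1})$ of $m+1$ distinct crossings of $D$, one has $\sum_{\vec i}(-1)^{|\vec i|}f(D_{\vec i})=0$, where $\vec i$ ranges over $\mathbb{Z}_2^{m+1}$ (vectors with entries $0,1$), $|\vec i|$ is the number of nonzero coordinates of $\vec i$, and $D_{\vec i}$ is the diagram $D$ with crossing $a_j$ changed whenever the $j$-th coordinate of $\vec i$ is one. It is of finite type if it is of finite type of order $\le m$ for some integer $m\ge0$. $t_{2n,q}$ moves: let $L$ be a link and $D^2$ an embedded disk which $L$ intersects transversely (in its interior), let $U=\partial D^2$ and $q=|\mathrm{lk}(L,U)|$. The complement of $U$ in $S^3$ is a solid torus $T$ with meridional disk $D^2$. A $t_{2,q}$ move on $L$ is the restriction to $L$ of a Dehn twist in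 $T$ on the disk $D^2$ (of a fixed handedness); that is, it cuts $L$ along $D^2$, inserts a full twist, and reglues. A $t_{2n,q}$ move is the result of $n$ such Dehn twists on $D^2$, i.e. $t_{2n,q}=t_{2,q}^n$. $(n,q)$-finite: a link invariant $f$ with values in an abelian group is $(n,q)$-finite of order $\le m$ if for all links $L$ and all collections $D^2_1,\dots,D^2_{m+1}$ of mutually disjoint embedded disks, each meeting $L$ transversely in its interior, with $\partial D_j^2=U_j$ and $q_j=\mathrm{lk}(U_j,L)\equiv 0 \pmod q$ for every $j$ (when $q=0$ this means $q_j=0$), one has $\sum_{\vec i}(-1)^{|\vec i|}f(L_{\vec i})=0$, where $\vec i$ ranges over $\mathbb{Z}_2^{m+1}$ and $L_{\vec i}$ is obtained from $L$ by performing a $t_{2n,q_j}$ move on the disk bounded by $U_j$ for each $j$ such that the $j$-th coordinate of $\vec i$ is one. Order $0$ means order $\le 0$; that is, $f$ is unchanged under every $t_{2n,q'}$ move with $q'$ a multiple of $q$.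
   Formalization: The second sentence is proved for every n ≥ 2 and even q; for n = 1 it fails, since every crossing change is a t_{2,0} move, so every order 0 (1,q)-finite invariant is unchanged by crossing changes and hence of finite type. *)

theory Defs
  imports "HOL-Number_Theory.Cong" "HOL-Library.FuncSet"
begin

text \<open>
  Oriented links are represented by oriented link diagrams in Morse position, read from bottom to
  top as a list of elementary slices, and are considered up to the planar-isotopy and Reidemeister
  moves for such sliced diagrams. Every oriented link diagram in the plane is planar isotopic to a
  sliced one with the same crossings.

  In the slice \<open>(i, e)\<close> there are \<open>i\<close> vertical strands to the left of the event \<open>e\<close>; the remaining
  strands are vertical and lie to its right. In \<open>Cross True\<close> the strand from bottom left to top right
  is the overcrossing one, in \<open>Cross False\<close> it is the strand from bottom right to top left. The
  argument of \<open>Cup\<close> is the orientation of its left leg.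
\<close>

datatype event = Cup bool | Cap | Cross bool

type_synonym slice = "nat \<times> event"
type_synonym diagram = "slice list"

text \<open>
  A horizontal level of a diagram is described by the orientations of the strands meeting it, from
  left to right; \<open>True\<close> means upwards.
\<close>

fun fits :: "bool list \<Rightarrow> slice \<Rightarrow> bool" where
  "fits \<sigma> (i, Cup b) \<longleftrightarrow> i \<le> length \<sigma>"
| "fits \<sigma> (i, Cap) \<longleftrightarrow> i + 1 < length \<sigma> \<and> \<sigma> ! i \<noteq> \<sigma> ! (i + 1)"
| "fits \<sigma> (i, Cross s) \<longleftrightarrow> i + 1 < length \<sigma>"

fun step :: "bool list \<Rightarrow> slice \<Rightarrow> bool list" where
  "step \<sigma> (i, Cup b) = take i \<sigma> @ [b, \<not> b] @ drop i \<sigma>"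
| "step \<sigma> (i, Cap) = take i \<sigma> @ drop (i + 2) \<sigma>"
| "step \<sigma> (i, Cross s) = \<sigma>[i := \<sigma> ! (i + 1), i + 1 := \<sigma> ! i]"

definition level :: "diagram \<Rightarrow> nat \<Rightarrow> bool list" where
  "level D t = foldl step [] (take t D)"

definition link_diagram :: "diagram \<Rightarrow> bool" where
  "link_diagram D \<longleftrightarrow> (\<forall>t < length D. fits (level D t) (D ! t)) \<and> level D (length D) = []"


section \<open>Isotopy of links\<close>

fun strands_in :: "event \<Rightarrow> nat" where
  "strands_in (Cup b) = 0"
| "strands_in Cap = 2"
| "strands_in (Cross s) = 2"

fun strands_out :: "event \<Rightarrow> nat" where
  "strands_out (Cup b) = 2"
| "strands_out Cap = 0"
| "strands_out (Cross s) = 2"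

text \<open>
  The first five rules generate planar isotopy: interchanging the heights of two horizontally
  disjoint events, straightening a zigzag, and moving a strand across a minimum or a maximum. The
  others are the Reidemeister moves. In \<open>R3\<close>, the bits \<open>a\<close>, \<open>b\<close>, \<open>c\<close> say whether, at the bottom
  level, strand 1 is over strand 2, strand 1 over strand 3, and strand 2 over strand 3; the side
  condition says that these choices come from a linear ordering of the three strands by height.
\<close>

inductive local_move :: "diagram \<Rightarrow> diagram \<Rightarrow> bool" where
  interchange: "local_move [(i, x), (i + strands_out x + d, y)] [(i + strands_in x + d, y), (i, x)]"
| zigzag_left: "local_move [(i + 1, Cup b), (i, Cap)] []"
| zigzag_right: "local_move [(i, Cup b), (i + 1, Cap)] []"
| slide_cup: "local_move [(i, Cup b), (i + 1, Cross s)] [(i + 1, Cup b), (i, Cross (\<not> s))]"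
| slide_cap: "local_move [(i + 1, Cross s), (i, Cap)] [(i, Cross (\<not> s)), (i + 1, Cap)]"
| R1_cup: "local_move [(i, Cup b), (i, Cross s)] [(i, Cup (\<not> b))]"
| R1_cap: "local_move [(i, Cross s), (i, Cap)] [(i, Cap)]"
| R2: "local_move [(i, Cross s), (i, Cross (\<not> s))] []"
| R3: "\<not> (a = c \<and> b \<noteq> a) \<Longrightarrow>
    local_move [(i, Cross a), (i + 1, Cross b), (i, Cross c)]
               [(i + 1, Cross c), (i, Cross b), (i + 1, Cross a)]"

definition diagram_move :: "diagram \<Rightarrow> diagram \<Rightarrow> bool" where
  "diagram_move D D' \<longleftrightarrow> link_diagram D \<and> link_diagram D' \<and>
    (\<exists>us vs A B. local_move A B \<and> D = us @ A @ vs \<and> D' = us @ B @ vs)"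

definition isotopic :: "diagram \<Rightarrow> diagram \<Rightarrow> bool" where
  "isotopic D D' \<longleftrightarrow> link_diagram D \<and> link_diagram D' \<and> equivclp diagram_move D D'"

definition link_invariant :: "(diagram \<Rightarrow> 'a) \<Rightarrow> bool" where
  "link_invariant f \<longleftrightarrow> (\<forall>D D'. isotopic D D' \<longrightarrow> f D = f D')"


section \<open>Fox colorings\<close>

text \<open>
  The point \<open>(t, j)\<close> is the \<open>j\<close>-th strand at level \<open>t\<close>. Arcs are classes of points under the relation
  generated by following a strand through one slice, where the undercrossing strand of a crossing
  is cut.
\<close>

definition points :: "diagram \<Rightarrow> (nat \<times> nat) set" where
  "points D = {(t, j). t \<le> length D \<and> j < length (level D t)}"

inductive joined :: "diagram \<Rightarrow> nat \<times> nat \<Rightarrow> nat \<times> nat \<Rightarrow> bool" for D where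
  left: "t < length D \<Longrightarrow> D ! t = (i, e) \<Longrightarrow> j < i \<Longrightarrow> joined D (t, j) (t + 1, j)"
| right: "t < length D \<Longrightarrow> D ! t = (i, e) \<Longrightarrow> i + strands_in e + d < length (level D t) \<Longrightarrow>
    joined D (t, i + strands_in e + d) (t + 1, i + strands_out e + d)"
| cup: "t < length D \<Longrightarrow> D ! t = (i, Cup b) \<Longrightarrow> joined D (t + 1, i) (t + 1, i + 1)"
| cap: "t < length D \<Longrightarrow> D ! t = (i, Cap) \<Longrightarrow> joined D (t, i) (t, i + 1)"
| over_right: "t < length D \<Longrightarrow> D ! t = (i, Cross True) \<Longrightarrow> joined D (t, i) (t + 1, i + 1)"
| over_left: "t < length D \<Longrightarrow> D ! t = (i, Cross False) \<Longrightarrow> joined D (t, i + 1) (t + 1, i)"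

definition arc :: "diagram \<Rightarrow> nat \<times> nat \<Rightarrow> (nat \<times> nat) set" where
  "arc D p = {p' \<in> points D. equivclp (joined D) p p'}"

definition arcs :: "diagram \<Rightarrow> (nat \<times> nat) set set" where
  "arcs D = arc D ` points D"

text \<open>
  The residues \<open>{0..<k}\<close> represent the ring of integers modulo \<open>k\<close>.
\<close>

definition colorings :: "nat \<Rightarrow> diagram \<Rightarrow> ((nat \<times> nat) set \<Rightarrow> int) set" where
  "colorings k D = {c \<in> arcs D \<rightarrow>\<^sub>E {0..<int k}. \<forall>t i.
     (t < length D \<and> D ! t = (i, Cross True) \<longrightarrow>
        [2 * c (arc D (t, i)) = c (arc D (t, i + 1)) + c (arc D (t + 1, i))] (mod int k)) \<and>
     (t < length D \<and> D ! t = (i, Cross False) \<longrightarrow>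
        [2 * c (arc D (t, i + 1)) = c (arc D (t, i)) + c (arc D (t + 1, i + 1))] (mod int k))}"

definition num_colorings :: "nat \<Rightarrow> diagram \<Rightarrow> nat" where
  "num_colorings k D = card (colorings k D)"


section \<open>Alternating sums and finite type invariants\<close>

text \<open>
  A vector with entries 0 and 1 indexed by the finite set \<open>A\<close> is given by its support \<open>S\<close>.
\<close>

definition alternating_sum :: "'b set \<Rightarrow> ('b set \<Rightarrow> 'a::ab_group_add) \<Rightarrow> 'a" where
  "alternating_sum A g = (\<Sum>S\<in>Pow A. if even (card S) then g S else - g S)"

definition crossings :: "diagram \<Rightarrow> nat set" where
  "crossings D = {t. t < length D \<and> (\<exists>i s. D ! t = (i, Cross s))}"

fun switch :: "slice \<Rightarrow> slice" where
  "switch (i, Cross s) = (i, Cross (\<not> s))"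
| "switch (i, Cup b) = (i, Cup b)"
| "switch (i, Cap) = (i, Cap)"

definition change_crossings :: "nat set \<Rightarrow> diagram \<Rightarrow> diagram" where
  "change_crossings S D = map (\<lambda>t. if t \<in> S then switch (D ! t) else D ! t) [0..<length D]"

definition finite_type_order_le :: "nat \<Rightarrow> (diagram \<Rightarrow> 'a::ab_group_add) \<Rightarrow> bool" where
  "finite_type_order_le m f \<longleftrightarrow> link_invariant f \<and>
    (\<forall>D A. link_diagram D \<and> A \<subseteq> crossings D \<and> card A = m + 1 \<longrightarrow>
       alternating_sum A (\<lambda>S. f (change_crossings S D)) = 0)"

definition finite_type :: "(diagram \<Rightarrow> 'a::ab_group_add) \<Rightarrow> bool" where
  "finite_type f \<longleftrightarrow> (\<exists>m. finite_type_order_le m f)"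


section \<open>Twisting along disks\<close>

text \<open>
  A link together with disjoint embedded disks transverse to it is isotopic to one where the disks
  are flat, horizontal and perpendicular to the plane of projection, at distinct heights which
  avoid the events. Such a configuration is a sliced diagram with markers inserted between the
  slices: \<open>Disk i w\<close> is a disk met exactly by the \<open>w\<close> consecutive strands \<open>i, ..., i + w - 1\<close> of
  the level where it is placed.
\<close>

datatype piece = Slice slice | Disk nat nat

type_synonym disk_diagram = "piece list"

definition disks :: "disk_diagram \<Rightarrow> nat set" where
  "disks E = {p. p < length E \<and> (\<exists>i w. E ! p = Disk i w)}"

text \<open>
  The right-handed full twist on \<open>w\<close> strands is the \<open>w\<close>-th power of the braid
  \<open>\<sigma>\<^sub>1 \<dots> \<sigma>\<^sub>w\<^sub>-\<^sub>1\<close>, where each generator is a positive crossing when both strands are oriented upwards.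
\<close>

definition full_twist :: "nat \<Rightarrow> nat \<Rightarrow> diagram" where
  "full_twist i w = concat (replicate w (map (\<lambda>j. (j, Cross True)) [i..<i + w - 1]))"

fun twist_piece :: "nat \<Rightarrow> bool \<Rightarrow> piece \<Rightarrow> diagram" where
  "twist_piece n on (Slice x) = [x]"
| "twist_piece n on (Disk i w) = (if on then concat (replicate n (full_twist i w)) else [])"

definition twisted :: "nat \<Rightarrow> nat set \<Rightarrow> disk_diagram \<Rightarrow> diagram" where
  "twisted n S E = concat (map (\<lambda>p. twist_piece n (p \<in> S) (E ! p)) [0..<length E])"

definition underlying :: "disk_diagram \<Rightarrow> diagram" where
  "underlying E = twisted 0 {} E"

definition disk_level :: "disk_diagram \<Rightarrow> nat \<Rightarrow> bool list" where
  "disk_level E p = foldl step [] (underlying (take p E))"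

definition link_with_disks :: "disk_diagram \<Rightarrow> bool" where
  "link_with_disks E \<longleftrightarrow> link_diagram (underlying E) \<and>
    (\<forall>p i w. p < length E \<and> E ! p = Disk i w \<longrightarrow> i + w \<le> length (disk_level E p))"

text \<open>
  The linking number of the link with the boundary of a disk (oriented so that upward strands
  count positively) is the algebraic intersection number of the link with the disk.
\<close>

definition disk_lk :: "disk_diagram \<Rightarrow> nat \<Rightarrow> int" where
  "disk_lk E p = (case E ! p of
      Slice x \<Rightarrow> 0
    | Disk i w \<Rightarrow> (\<Sum>j\<in>{i..<i + w}. if disk_level E p ! j then 1 else - 1))"

definition nq_finite_order_le ::
  "nat \<Rightarrow> nat \<Rightarrow> nat \<Rightarrow> (diagram \<Rightarrow> 'a::ab_group_add) \<Rightarrow> bool" where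
  "nq_finite_order_le n q m f \<longleftrightarrow> link_invariant f \<and>
    (\<forall>E. link_with_disks E \<and> card (disks E) = m + 1 \<and>
         (\<forall>p\<in>disks E. [disk_lk E p = 0] (mod int q)) \<longrightarrow>
       alternating_sum (disks E) (\<lambda>S. f (twisted n S E)) = 0)"

end

theory Submission
  imports Defs
begin

text \<open>
  A coloring of a sliced diagram is determined by the colors of the strands at each level, and each
  slice restricts the colors above it in terms of those below it. Counting colorings therefore means
  composing one operator per slice (\<open>extensions\<close>). This is equal to the count of Fox colorings by arcs
  (\<open>num_colorings_eq_extensions\<close>), and it makes both the Reidemeister moves and the twist moves local
  questions.

  \<^emph>\<open>Order 0.\<close> A strand of color \<open>x\<close> reflects the color of a strand crossing under it in \<open>x\<close>. A full
  twist on \<open>w\<close> strands with colors \<open>x\<^sub>0, \<dots>\<close> transforms all colors by the composition of the reflections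
  in \<open>x\<^sub>0, \<dots>\<close>. If \<open>w\<close> is even, this composition is the translation by \<open>2 * s\<close>, where
  \<open>s = x\<^sub>0 - x\<^sub>1 + \<dots>\<close>. Translating an even number of colors does not change \<open>s\<close>, so \<open>n\<close> full twists
  translate by \<open>2 * n * s\<close>, which is 0 modulo \<open>2 * n\<close> (\<open>extensions_twists_trivial\<close>). For even \<open>q\<close>, a
  linking number divisible by \<open>q\<close> forces \<open>w\<close> to be even.

  \<^emph>\<open>Not of finite type.\<close> On the closures of the 2-braids with exponent \<open>e\<close>, the number of
  \<open>k\<close>-colorings depends only on \<open>e\<close> modulo \<open>k\<close> (\<open>torus_count_periodic\<close>). An invariant of finite type
  restricts to a polynomial in \<open>x\<close> on the closures with \<open>e = 2 * x\<close>, and a periodic polynomial is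
  constant. For even \<open>k > 2\<close> the values at \<open>e = 0\<close> and \<open>e = 2\<close> differ
  (\<open>not_finite_type_num_colorings\<close>). So for \<open>n \<ge> 2\<close> the number of \<open>2 * n\<close>-colorings itself is the
  required example; for \<open>n = 1\<close> it is a function of the number of components only.
\<close>


section \<open>Counting colorings slice by slice\<close>

definition reflect :: "nat \<Rightarrow> int \<Rightarrow> int \<Rightarrow> int" where
  "reflect k x y = (2 * x - y) mod int k"

text \<open>
  The colors of the outgoing strands of an event that the colors of its incoming strands allow. At a
  crossing the overcrossing strand keeps its color and the other one is reflected in it.
\<close>

fun passages :: "nat \<Rightarrow> event \<Rightarrow> int list \<Rightarrow> int list set" where
  "passages k (Cup b) xs = (\<lambda>a. [a, a]) ` {0..<int k}"
| "passages k Cap xs = (if xs ! 0 = xs ! 1 then {[]} else {})"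
| "passages k (Cross s) xs =
    {if s then [reflect k (xs ! 0) (xs ! 1), xs ! 0] else [xs ! 1, reflect k (xs ! 1) (xs ! 0)]}"

fun successors :: "nat \<Rightarrow> slice \<Rightarrow> int list \<Rightarrow> int list set" where
  "successors k (i, e) xs =
    (\<lambda>m. take i xs @ m @ drop (i + strands_in e) xs) ` passages k e (take (strands_in e) (drop i xs))"

definition transfer :: "nat \<Rightarrow> slice \<Rightarrow> (int list \<Rightarrow> nat) \<Rightarrow> int list \<Rightarrow> nat" where
  "transfer k s F xs = (\<Sum>ys\<in>successors k s xs. F ys)"

text \<open>
  For \<open>F = (\<lambda>_. 1)\<close> this is the number of ways of extending the colors at the bottom of \<open>D\<close> to all of
  \<open>D\<close>. A general weight \<open>F\<close> on the colors at the top makes stacking of diagrams correspond to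
  composition of operators, so that a local change in the middle of a diagram can be studied alone.
\<close>

definition extensions :: "nat \<Rightarrow> diagram \<Rightarrow> (int list \<Rightarrow> nat) \<Rightarrow> int list \<Rightarrow> nat" where
  "extensions k D = foldr (transfer k) D"

definition states :: "nat \<Rightarrow> nat \<Rightarrow> int list set" where
  "states k L = {xs. length xs = L \<and> set xs \<subseteq> {0..<int k}}"

text \<open>
  Colorings do not see orientations. It is enough to require that every slice finds the strands that
  it acts on when the bottom level has \<open>L\<close> strands. For twisted diagrams this condition is immediate,
  while \<open>link_diagram\<close> would require an analysis of the permutation of the strands.
\<close>

fun sized :: "nat \<Rightarrow> diagram \<Rightarrow> bool" where
  "sized L [] \<longleftrightarrow> True"
| "sized L ((i, e) # D) \<longleftrightarrow> i + strands_in e \<le> L \<and> sized (L - strands_in e + strands_out e) D"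

fun width :: "nat \<Rightarrow> diagram \<Rightarrow> nat" where
  "width L [] = L"
| "width L ((i, e) # D) = width (L - strands_in e + strands_out e) D"

lemma extensions_Nil [simp]: "extensions k [] F = F"
  by (simp add: extensions_def)

lemma extensions_Cons: "extensions k (s # D) F = transfer k s (extensions k D F)"
  by (simp add: extensions_def)

lemma extensions_append: "extensions k (A @ B) F = extensions k A (extensions k B F)"
  by (simp add: extensions_def)

lemma sized_append: "sized L (A @ B) \<longleftrightarrow> sized L A \<and> sized (width L A) B"
  by (induction L A rule: sized.induct) auto

lemma width_append: "width L (A @ B) = width (width L A) B"
  by (induction L A rule: sized.induct) auto

lemma length_passages: "m \<in> passages k e xs \<Longrightarrow> length m = strands_out e"
  by (cases e) (auto split: if_splits)

lemma finite_passages: "finite (passages k e xs)"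
  by (cases e) auto

lemma transfer_block:
  assumes "length P = i" "length M = strands_in e"
  shows "transfer k (i, e) F (P @ M @ R) = (\<Sum>m\<in>passages k e M. F (P @ m @ R))"
proof -
  have "successors k (i, e) (P @ M @ R) = (\<lambda>m. P @ m @ R) ` passages k e M"
    using assms by simp
  moreover have "inj_on (\<lambda>m. P @ m @ R) (passages k e M)"
    by (auto simp: inj_on_def)
  ultimately show ?thesis
    by (simp add: transfer_def sum.reindex)
qed

lemma split_block:
  assumes "i + l \<le> length xs"
  obtains P M R where "xs = P @ M @ R" "length P = i" "length M = l"
proof -
  have "xs = take i xs @ take l (drop i xs) @ drop l (drop i xs)"
    by (metis append_take_drop_id)
  then show ?thesis using assms by (intro that[of "take i xs"]) auto
qed

lemma reflect_range: "k > 0 \<Longrightarrow> reflect k x y \<in> {0..<int k}"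
  by (simp add: reflect_def)

lemma passages_range:
  assumes "k > 0" "m \<in> passages k e xs" "set xs \<subseteq> {0..<int k}" "length xs = strands_in e"
  shows "set m \<subseteq> {0..<int k}"
proof (cases e)
  case (Cross s)
  then obtain x y where "xs = [x, y]"
    using assms by (auto simp: length_Suc_conv numeral_2_eq_2)
  then show ?thesis
    using Cross assms reflect_range[of k] by (auto split: if_splits)
qed (use assms in \<open>auto split: if_splits\<close>)

lemma successors_states:
  assumes "k > 0" "xs \<in> states k L" "i + strands_in e \<le> L" "ys \<in> successors k (i, e) xs"
  shows "ys \<in> states k (L - strands_in e + strands_out e)"
proof -
  obtain P M R where xs: "xs = P @ M @ R" "length P = i" "length M = strands_in e"
    using assms split_block[of i "strands_in e" xs] by (auto simp: states_def)
  then obtain m where m: "m \<in> passages k e M" "ys = P @ m @ R"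
    using assms by auto
  then show ?thesis
    using xs assms passages_range[of k m e M] length_passages[of m k e M]
    by (auto simp: states_def)
qed

lemma extensions_cong:
  assumes "k > 0" "sized L D" "xs \<in> states k L"
    and "\<And>ys. ys \<in> states k (width L D) \<Longrightarrow> F ys = G ys"
  shows "extensions k D F xs = extensions k D G xs"
  using assms
proof (induction D arbitrary: L xs)
  case (Cons s D)
  obtain i e where s: "s = (i, e)" by (cases s)
  show ?case
    unfolding extensions_Cons transfer_def
  proof (rule sum.cong)
    fix ys assume "ys \<in> successors k s xs"
    then have "ys \<in> states k (L - strands_in e + strands_out e)"
      using Cons.prems s successors_states by auto
    then show "extensions k D F ys = extensions k D G ys"
      using Cons.prems s by (intro Cons.IH[of "L - strands_in e + strands_out e"]) auto
  qed simp
qed simp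

section \<open>Isotopy invariance of the operators\<close>

lemma length_2E: assumes "length M = 2" obtains x y where "M = [x, y]"
  using assms by (auto simp: length_Suc_conv numeral_2_eq_2)

lemma transfer_cup: "length P = i \<Longrightarrow>
  transfer k (i, Cup b) F (P @ R) = (\<Sum>a\<in>{0..<int k}. F (P @ a # a # R))"
  using transfer_block[of P i "[]" "Cup b" k F R]
  by (simp add: sum.reindex inj_on_def)

lemma transfer_cap: "length P = i \<Longrightarrow>
  transfer k (i, Cap) F (P @ x # y # R) = (if x = y then F (P @ R) else 0)"
  using transfer_block[of P i "[x, y]" Cap k F R]
  by simp

lemma transfer_cross: "length P = i \<Longrightarrow>
  transfer k (i, Cross s) F (P @ x # y # R) =
    F (P @ (if s then reflect k x y # x # R else y # reflect k y x # R))"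
  using transfer_block[of P i "[x, y]" "Cross s" k F R]
  by simp

lemma reflect_reflect: "k > 0 \<Longrightarrow> y \<in> {0..<int k} \<Longrightarrow> reflect k x (reflect k x y) = y"
  by (simp add: reflect_def mod_simps)

lemma reflect_self: "x \<in> {0..<int k} \<Longrightarrow> reflect k x x = x"
  by (simp add: reflect_def)

lemma reflect_cong: "[reflect k x y = 2 * x - y] (mod int k)"
  by (simp add: reflect_def cong_def)

text \<open>
  The self-distributive law of the dihedral quandle, which is the content of the third Reidemeister
  move for Fox colorings.
\<close>

lemma reflect_distrib:
  "reflect k x (reflect k y z) = reflect k (reflect k x y) (reflect k x z)"
proof -
  have "[2 * x - reflect k y z = 2 * x - (2 * y - z)] (mod int k)"
    by (intro cong_diff cong_mult cong_refl reflect_cong)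
  also have "2 * x - (2 * y - z) = 2 * (2 * x - y) - (2 * x - z)"
    by simp
  also have "[\<dots> = 2 * reflect k x y - reflect k x z] (mod int k)"
    by (intro cong_diff cong_mult cong_refl cong_sym[OF reflect_cong])
  finally show ?thesis
    unfolding reflect_def[of k x "reflect k y z"] reflect_def[of k "reflect k x y" "reflect k x z"] cong_def .
qed

lemma reflect_fixed:
  assumes "x \<in> {0..<int k}" "y \<in> {0..<int k}"
  shows "reflect k x y = x \<longleftrightarrow> x = y"
proof
  assume "reflect k x y = x"
  then have "reflect k x (reflect k x y) = reflect k x x" by simp
  then show "x = y"
    using assms reflect_reflect[of k y x] reflect_self[of x k] by auto
qed (use assms reflect_self in auto)

lemma sum_delta_color:
  fixes g :: "int \<Rightarrow> nat"
  assumes "x \<in> {0..<int k}"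
  shows "(\<Sum>a\<in>{0..<int k}. if a = x then g a else 0) = g x"
    and "(\<Sum>a\<in>{0..<int k}. if x = a then g a else 0) = g x"
  using assms by simp_all

lemma split_state:
  assumes "xs \<in> states k L" "i + l \<le> L"
  obtains P M R where "xs = P @ M @ R" "length P = i" "length M = l"
    "set P \<subseteq> {0..<int k}" "set M \<subseteq> {0..<int k}" "set R \<subseteq> {0..<int k}"
proof -
  obtain P M R where "xs = P @ M @ R" "length P = i" "length M = l"
    using assms split_block[of i l xs] by (auto simp: states_def)
  then show ?thesis
    using assms by (intro that[of P M R]) (auto simp: states_def)
qed

text \<open>
  The two events act on disjoint blocks of strands, so both sides are the same double sum taken in
  the two possible orders.
\<close>

lemma extensions_interchange:
  assumes "length xs = L"
    and "sized L [(i, x), (i + strands_out x + d, y)]"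
    and "sized L [(i + strands_in x + d, y), (i, x)]"
  shows "extensions k [(i, x), (i + strands_out x + d, y)] F xs
       = extensions k [(i + strands_in x + d, y), (i, x)] F xs"
proof -
  have le: "i + strands_in x + d + strands_in y \<le> length xs"
    using assms by auto
  then have "i + strands_in x \<le> length xs"
    by simp
  then obtain P M Q where 1: "xs = P @ M @ Q" "length P = i" "length M = strands_in x"
    by (rule split_block)
  then have "d + strands_in y \<le> length Q"
    using le by simp
  then obtain C N R where 2: "Q = C @ N @ R" "length C = d" "length N = strands_in y"
    by (rule split_block)
  have xs: "xs = P @ M @ C @ N @ R"
    using 1 2 by simp
  have a: "transfer k (i + strands_out x + d, y) F (P @ m @ C @ N @ R)
       = (\<Sum>n\<in>passages k y N. F (P @ m @ C @ n @ R))" if "m \<in> passages k x M" for m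
    using transfer_block[of "P @ m @ C" "i + strands_out x + d" N y k F R] 1 2
      length_passages[OF that] by simp
  have b: "transfer k (i + strands_in x + d, y) G (P @ M @ C @ N @ R)
       = (\<Sum>n\<in>passages k y N. G (P @ M @ C @ n @ R))" for G
    using transfer_block[of "P @ M @ C" "i + strands_in x + d" N y k G R] 1 2 by simp
  have c: "transfer k (i, x) G (P @ M @ S) = (\<Sum>m\<in>passages k x M. G (P @ m @ S))" for S G
    using transfer_block[of P i M x k G S] 1 by simp
  show ?thesis
    unfolding extensions_Cons extensions_Nil xs b c
    by (subst sum.swap) (intro sum.cong refl a)
qed

text \<open>
  The Reidemeister moves reduce to the quandle laws: idempotency for R1, involutivity for R2 and
  self-distributivity for R3. In a zigzag the cap forces the new color to be that of the strand.
  Sliding a strand over or under an extremum relies on involutivity again.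
\<close>

lemma extensions_local_move:
  assumes "local_move A B" "k > 0" "sized L A" "sized L B" "xs \<in> states k L"
  shows "extensions k A F xs = extensions k B F xs"
  using assms
proof (induction rule: local_move.induct)
  case (interchange i x d y)
  then show ?case
    by (intro extensions_interchange[where L = L]) (auto simp: states_def)
next
  case (zigzag_left i b)
  then obtain P M R where xs: "xs = P @ M @ R" "length P = i" "length M = 1"
    "set M \<subseteq> {0..<int k}"
    by (elim split_state[of xs k L i 1]) auto
  then obtain x where x: "M = [x]" "x \<in> {0..<int k}"
    by (auto simp: length_Suc_conv)
  show ?case
    using xs x transfer_cup[of "P @ [x]" "i + 1" k b _ R]
    by (simp add: extensions_Cons transfer_cap sum_delta_color del: One_nat_def)
next
  case (zigzag_right i b)
  then obtain P M R where xs: "xs = P @ M @ R" "length P = i" "length M = 1"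
    "set M \<subseteq> {0..<int k}"
    by (elim split_state[of xs k L i 1]) auto
  then obtain x where x: "M = [x]" "x \<in> {0..<int k}"
    by (auto simp: length_Suc_conv)
  have "transfer k (i + 1, Cap) F (P @ a # a # x # R) = (if a = x then F (P @ a # R) else 0)" for a
    using xs transfer_cap[of "P @ [a]" "i + 1" k F a x R] by simp
  then show ?case
    using xs x by (simp add: extensions_Cons transfer_cup sum_delta_color)
next
  case (slide_cup i b s)
  then obtain P M R where xs: "xs = P @ M @ R" "length P = i" "length M = 1"
    "set M \<subseteq> {0..<int k}"
    by (elim split_state[of xs k L i 1]) auto
  then obtain x where x: "M = [x]" "x \<in> {0..<int k}"
    by (auto simp: length_Suc_conv)
  have a: "transfer k (i + 1, Cross s) F (P @ a # a # x # R)
     = F (P @ a # (if s then reflect k a x # a # R else x # reflect k x a # R))" for a s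
    using xs transfer_cross[of "P @ [a]" "i + 1" k s F a x R] by simp
  \<comment> \<open>When the straight strand passes over, the two sides color different legs of the minimum by the
    summation variable; these colors correspond under the reflection in \<open>x\<close>.\<close>
  have "(\<Sum>a\<in>{0..<int k}. F (P @ a # x # reflect k x a # R))
      = (\<Sum>a\<in>{0..<int k}. F (P @ reflect k x a # x # a # R))"
    by (rule sum.reindex_bij_witness[where i = "reflect k x" and j = "reflect k x"])
      (use \<open>k > 0\<close> reflect_reflect reflect_range in auto)
  then show ?case
    using xs x transfer_cup[of "P @ [x]" "i + 1" k b _ R]
    by (cases s) (simp_all add: extensions_Cons transfer_cup transfer_cross a[simplified])
next
  case (slide_cap i s)
  then obtain P M R where xs: "xs = P @ M @ R" "length P = i" "length M = 3"
    "set M \<subseteq> {0..<int k}"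
    by (elim split_state[of xs k L i 3]) auto
  then obtain x y z where x: "M = [x, y, z]" and r: "x \<in> {0..<int k}" "y \<in> {0..<int k}" "z \<in> {0..<int k}"
    by (auto simp: length_Suc_conv numeral_3_eq_3)
  have a: "transfer k (i + 1, Cross s) G (P @ x # y # z # R)
     = G (P @ x # (if s then reflect k y z # y # R else z # reflect k z y # R))" for G s
    using xs transfer_cross[of "P @ [x]" "i + 1" k s G y z R] by simp
  have b: "transfer k (i + 1, Cap) F (P @ u # v # w # R) = (if v = w then F (P @ u # R) else 0)" for u v w
    using xs transfer_cap[of "P @ [u]" "i + 1" k F v w R] by simp
  have c: "x = reflect k y z \<longleftrightarrow> reflect k y x = z"
    using reflect_reflect[of k _ y] r \<open>k > 0\<close> by metis
  show ?case
    using xs x c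
    by (cases s) (simp_all add: extensions_Cons transfer_cap transfer_cross a[simplified] b[simplified])
next
  case (R1_cup i b s)
  then obtain P R where xs: "xs = P @ R" "length P = i"
    by (elim split_state[of xs k L i 0]) auto
  show ?case
    using xs
    by (cases s) (auto simp: extensions_Cons transfer_cup transfer_cross reflect_self intro!: sum.cong)
next
  case (R1_cap i s)
  then obtain P M R where xs: "xs = P @ M @ R" "length P = i" "length M = 2"
    "set M \<subseteq> {0..<int k}"
    by (elim split_state[of xs k L i 2]) auto
  then obtain x y where x: "M = [x, y]" and r: "x \<in> {0..<int k}" "y \<in> {0..<int k}"
    by (auto elim!: length_2E)
  show ?case
    using xs x reflect_fixed[OF r] reflect_fixed[OF r(2,1)]
    by (cases s) (auto simp: extensions_Cons transfer_cap transfer_cross)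
next
  case (R2 i s)
  then obtain P M R where xs: "xs = P @ M @ R" "length P = i" "length M = 2"
    "set M \<subseteq> {0..<int k}"
    by (elim split_state[of xs k L i 2]) auto
  then obtain x y where x: "M = [x, y]" and r: "x \<in> {0..<int k}" "y \<in> {0..<int k}"
    by (auto elim!: length_2E)
  show ?case
    using xs x reflect_reflect[OF \<open>k > 0\<close> r(1)] reflect_reflect[OF \<open>k > 0\<close> r(2)]
    by (cases s) (simp_all add: extensions_Cons transfer_cross)
next
  case (R3 a c b i)
  then obtain P M R where xs: "xs = P @ M @ R" "length P = i" "length M = 3"
    "set M \<subseteq> {0..<int k}"
    by (elim split_state[of xs k L i 3]) auto
  then obtain x y z where x: "M = [x, y, z]" and r: "x \<in> {0..<int k}" "y \<in> {0..<int k}" "z \<in> {0..<int k}"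
    by (auto simp: length_Suc_conv numeral_3_eq_3)
  have s: "transfer k (i + 1, Cross s) G (P @ u # v # w # R)
     = G (P @ u # (if s then reflect k v w # v # R else w # reflect k w v # R))" for G s u v w
    using xs transfer_cross[of "P @ [u]" "i + 1" k s G v w R] by simp
  have e: "reflect k y (reflect k (reflect k y u) v) = reflect k u (reflect k y v)"
    if "u \<in> {0..<int k}" for u v
    using reflect_distrib[of k y "reflect k y u" v] reflect_reflect[OF \<open>k > 0\<close> that] by simp
  note d = reflect_distrib[symmetric]
  show ?case
    using xs x r \<open>k > 0\<close> R3.hyps
    by (cases a; cases b; cases c)
      (simp_all add: extensions_Cons transfer_cross s[simplified] reflect_reflect d e[OF r(1)] e[OF r(3)])
qed


section \<open>Colorings of arcs and colorings of levels\<close>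

lemma width_level:
  assumes "sized 0 D" "t \<le> length D"
  shows "length (level D t) = width 0 (take t D)"
proof -
  have "length (foldl step \<sigma> D) = width (length \<sigma>) D" if "sized (length \<sigma>) D" for \<sigma> D
    using that
  proof (induction D arbitrary: \<sigma>)
    case (Cons s D)
    obtain i e where s: "s = (i, e)" by (cases s)
    have "length (step \<sigma> s) = length \<sigma> - strands_in e + strands_out e"
      using Cons.prems s by (cases e) auto
    then show ?case
      using Cons s by auto
  qed simp
  moreover have "sized 0 (take t D)"
    using assms(1) sized_append[of 0 "take t D" "drop t D"] by simp
  ultimately show ?thesis
    by (simp add: level_def)
qed

lemma sized_level:
  assumes "sized 0 D" "t < length D" "D ! t = (i, e)"
  shows "i + strands_in e \<le> length (level D t)"
    and "length (level D (Suc t)) = length (level D t) - strands_in e + strands_out e"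
proof -
  have D: "D = take t D @ (i, e) # drop (Suc t) D"
    using assms by (metis id_take_nth_drop)
  then have "sized (width 0 (take t D)) ((i, e) # drop (Suc t) D)"
    using assms(1) sized_append by metis
  then show "i + strands_in e \<le> length (level D t)"
    using assms by (simp add: width_level)
  show "length (level D (Suc t)) = length (level D t) - strands_in e + strands_out e"
    using assms by (simp add: width_level take_Suc_conv_app_nth width_append)
qed

lemma link_diagram_sized:
  assumes "link_diagram D" shows "sized 0 D"
proof -
  have "sized (length \<sigma>) D" if "\<forall>t<length D. fits (foldl step \<sigma> (take t D)) (D ! t)" for \<sigma> D
    using that
  proof (induction D arbitrary: \<sigma>)
    case (Cons s D)
    obtain i e where s: "s = (i, e)" by (cases s)
    have f: "fits \<sigma> (i, e)"
      using Cons.prems s by (auto dest: spec[of _ 0])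
    then have "i + strands_in e \<le> length \<sigma>"
      by (cases e) auto
    moreover have "length (step \<sigma> s) = length \<sigma> - strands_in e + strands_out e"
      using f s by (cases e) auto
    moreover have "sized (length (step \<sigma> s)) D"
      using Cons.prems by (intro Cons.IH) force
    ultimately show ?case
      using s by simp
  qed simp
  from this[of D "[]"] show ?thesis
    using assms by (simp add: link_diagram_def level_def)
qed

lemma level_0 [simp]: "level D 0 = []"
  by (simp add: level_def)

text \<open>
  A coloring recorded as the list of the color lists at all levels, from the bottom \<open>xs\<close> upwards.
\<close>

fun paths :: "nat \<Rightarrow> diagram \<Rightarrow> int list \<Rightarrow> int list list set" where
  "paths k [] xs = {[xs]}"
| "paths k (s # D) xs = (\<Union>ys\<in>successors k s xs. (#) xs ` paths k D ys)"

lemma hd_paths: "p \<in> paths k D xs \<Longrightarrow> p \<noteq> [] \<and> hd p = xs"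
  by (cases D) auto

lemma finite_successors: "finite (successors k s xs)"
  by (cases s) (simp add: finite_passages)

lemma card_paths: "finite (paths k D xs) \<and> card (paths k D xs) = extensions k D (\<lambda>_. 1) xs"
proof (induction D arbitrary: xs)
  case (Cons s D)
  have "card (paths k (s # D) xs) = (\<Sum>ys\<in>successors k s xs. card ((#) xs ` paths k D ys))"
    unfolding paths.simps
  proof (rule card_UN_disjoint)
    show "\<forall>ys\<in>successors k s xs. \<forall>zs\<in>successors k s xs. ys \<noteq> zs \<longrightarrow>
        (#) xs ` paths k D ys \<inter> (#) xs ` paths k D zs = {}"
      by (auto dest: hd_paths)
  qed (use Cons finite_successors in auto)
  also have "\<dots> = (\<Sum>ys\<in>successors k s xs. extensions k D (\<lambda>_. 1) ys)"
    using Cons by (intro sum.cong refl) (simp add: card_image)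
  finally show ?case
    using Cons finite_successors by (simp add: extensions_Cons transfer_def)
qed simp

lemma paths_iff:
  "p \<in> paths k D xs \<longleftrightarrow> length p = Suc (length D) \<and> p ! 0 = xs \<and>
     (\<forall>t<length D. p ! Suc t \<in> successors k (D ! t) (p ! t))"
proof (induction D arbitrary: p xs)
  case Nil
  then show ?case by (auto simp: length_Suc_conv)
next
  case (Cons s D)
  show ?case
  proof (cases p)
    case Nil
    then show ?thesis by auto
  next
    case (Cons x q)
    then show ?thesis
      by (auto simp: Cons.IH All_less_Suc2 image_iff)
  qed
qed

text \<open>
  The conditions that one slice imposes on the colors \<open>u\<close> below and \<open>v\<close> above it, when there are \<open>L\<close>
  strands below: they are the instances of \<open>joined\<close> and of the Fox relation coming from this slice.
\<close>

fun compatible :: "nat \<Rightarrow> nat \<Rightarrow> slice \<Rightarrow> (nat \<Rightarrow> int) \<Rightarrow> (nat \<Rightarrow> int) \<Rightarrow> bool" where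
  "compatible k L (i, e) u v \<longleftrightarrow>
     (\<forall>j<i. u j = v j) \<and>
     (\<forall>d. i + strands_in e + d < L \<longrightarrow> u (i + strands_in e + d) = v (i + strands_out e + d)) \<and>
     (case e of
        Cup b \<Rightarrow> v i = v (i + 1)
      | Cap \<Rightarrow> u i = u (i + 1)
      | Cross s \<Rightarrow>
          if s then u i = v (i + 1) \<and> [2 * u i = u (i + 1) + v i] (mod int k)
          else u (i + 1) = v i \<and> [2 * u (i + 1) = u i + v (i + 1)] (mod int k))"

lemma compatible_cong:
  assumes "i + strands_in e \<le> L"
    and "\<And>j. j < L \<Longrightarrow> u j = u' j"
    and "\<And>j. j < L - strands_in e + strands_out e \<Longrightarrow> v j = v' j"
  shows "compatible k L (i, e) u v \<longleftrightarrow> compatible k L (i, e) u' v'"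
proof -
  have 1: "j < i \<Longrightarrow> u j = u' j \<and> v j = v' j" for j
    using assms by simp
  have 2: "i + strands_in e + d < L \<Longrightarrow>
      u (i + strands_in e + d) = u' (i + strands_in e + d) \<and>
      v (i + strands_out e + d) = v' (i + strands_out e + d)" for d
    using assms(1) by (intro conjI assms(2,3)) linarith+
  have 3: "j < strands_in e \<Longrightarrow> u (i + j) = u' (i + j)" for j
    using assms(1) by (intro assms(2)) linarith
  have 4: "j < strands_out e \<Longrightarrow> v (i + j) = v' (i + j)" for j
    using assms(1) by (intro assms(3)) linarith
  show ?thesis
    using 1 2 3[of 0] 3[of 1] 4[of 0] 4[of 1]
    by (cases e) (auto split: event.split)
qed

lemma reflect_eq_iff:
  assumes "z \<in> {0..<int k}"
  shows "z = reflect k x y \<longleftrightarrow> [2 * x = y + z] (mod int k)"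
proof -
  have "z = reflect k x y \<longleftrightarrow> [z = 2 * x - y] (mod int k)"
    using assms by (simp add: reflect_def cong_def)
  also have "\<dots> \<longleftrightarrow> [2 * x = y + z] (mod int k)"
    by (simp add: cong_iff_dvd_diff algebra_simps dvd_diff_commute)
  finally show ?thesis .
qed

lemma block_eqI:
  assumes "length xs = length P + l + length R" 
    and "\<And>j. j < length P \<Longrightarrow> xs ! j = P ! j"
    and "\<And>d. d < length R \<Longrightarrow> xs ! (length P + l + d) = R ! d"
  shows "xs = P @ take l (drop (length P) xs) @ R"
proof -
  have "xs = take (length P) xs @ take l (drop (length P) xs) @ drop l (drop (length P) xs)"
    by (metis append_take_drop_id)
  moreover have "take (length P) xs = P"
    using assms by (intro nth_equalityI) auto
  moreover have "drop l (drop (length P) xs) = R"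
    using assms by (intro nth_equalityI) (auto simp: add.commute add.left_commute)
  ultimately show ?thesis
    by simp
qed

text \<open>
  Outside the block of the event the colors are copied; on the block, the finitely many conditions
  are those describing \<open>passages\<close>. The Fox relation determines the reflected color because colors are
  reduced residues.
\<close>

lemma successors_iff_compatible:
  assumes "k > 0" "xs \<in> states k L" "i + strands_in e \<le> L"
    and "ys \<in> states k (L - strands_in e + strands_out e)"
  shows "ys \<in> successors k (i, e) xs \<longleftrightarrow> compatible k L (i, e) ((!) xs) ((!) ys)"
proof -
  obtain P M R where xs: "xs = P @ M @ R" "length P = i" "length M = strands_in e"
    using assms(2,3) by (rule split_state)
  have L: "L = i + strands_in e + length R"
    using xs assms(2) by (auto simp: states_def)
  have ys: "length ys = length P + strands_out e + length R"
    using L assms(4) xs by (auto simp: states_def)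
  define N where "N = take (strands_out e) (drop (length P) ys)"
  have lenN: "length N = strands_out e"
    using ys by (simp add: N_def)
  have succ: "successors k (i, e) xs = (\<lambda>m. P @ m @ R) ` passages k e M"
    using xs by simp
  have outer: "(\<forall>j<i. xs ! j = ys ! j) \<and>
     (\<forall>d. i + strands_in e + d < L \<longrightarrow> xs ! (i + strands_in e + d) = ys ! (i + strands_out e + d))
     \<longleftrightarrow> ys = P @ N @ R" (is "?l \<longleftrightarrow> ?r")
  proof
    assume ?l
    then show ?r
      unfolding N_def using ys xs L
      by (intro block_eqI) (auto simp: nth_append)
  next
    assume r: ?r
    show ?l
      by (subst (1 2) r) (use xs lenN L in \<open>auto simp: nth_append\<close>)
  qed
  show ?thesis
  proof (cases "ys = P @ N @ R")
    case False
    have "ys \<notin> successors k (i, e) xs"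
    proof
      assume "ys \<in> successors k (i, e) xs"
      then obtain m where "m \<in> passages k e M" "ys = P @ m @ R"
        unfolding succ by blast
      then show False
        using False length_passages[of m k e M] by (simp add: N_def)
    qed
    then show ?thesis
      using False outer by auto
  next
    case True
    have u: "xs ! (i + j) = M ! j" if "j < strands_in e" for j
      using that xs by (simp add: nth_append)
    have v: "ys ! (i + j) = N ! j" if "j < strands_out e" for j
      by (subst True) (use that xs lenN in \<open>simp add: nth_append\<close>)
    have N: "set N \<subseteq> {0..<int k}"
      using assms(4) unfolding states_def N_def by (auto dest!: in_set_takeD in_set_dropD)
    have M: "set M \<subseteq> {0..<int k}"
      using assms(2) unfolding states_def xs by auto
    have "ys \<in> successors k (i, e) xs \<longleftrightarrow> N \<in> passages k e M"
      unfolding succ by (subst True) auto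
    also have "\<dots> \<longleftrightarrow> (case e of
        Cup b \<Rightarrow> N ! 0 = N ! 1
      | Cap \<Rightarrow> M ! 0 = M ! 1
      | Cross s \<Rightarrow>
          if s then M ! 0 = N ! 1 \<and> [2 * M ! 0 = M ! 1 + N ! 0] (mod int k)
          else M ! 1 = N ! 0 \<and> [2 * M ! 1 = M ! 0 + N ! 1] (mod int k))"
    proof (cases e)
      case (Cup b)
      then obtain a c where "N = [a, c]"
        using lenN by (auto elim!: length_2E)
      then show ?thesis
        using Cup N by auto
    next
      case Cap
      then show ?thesis using lenN by auto
    next
      case (Cross s)
      then obtain a c where "N = [a, c]"
        using lenN by (auto elim!: length_2E)
      moreover obtain x y where "M = [x, y]"
        using Cross xs by (auto elim!: length_2E)
      ultimately show ?thesis
        using Cross N reflect_eq_iff[of a k x y] reflect_eq_iff[of c k y x]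
        by auto
    qed
    also have "\<dots> \<longleftrightarrow> compatible k L (i, e) ((!) xs) ((!) ys)"
      using u[of 0] u[of 1] v[of 0] v[of 1] outer True
      by (cases e) auto
    finally show ?thesis .
  qed
qed


text \<open>
  Intermediate between colorings of arcs and paths: the color of an arc is repeated at each of its
  points.
\<close>

definition point_colorings :: "nat \<Rightarrow> diagram \<Rightarrow> (nat \<times> nat \<Rightarrow> int) set" where
  "point_colorings k D = {\<phi> \<in> points D \<rightarrow>\<^sub>E {0..<int k}. \<forall>t<length D.
     compatible k (length (level D t)) (D ! t) (\<lambda>j. \<phi> (t, j)) (\<lambda>j. \<phi> (Suc t, j))}"

lemma joined_points:
  assumes "sized 0 D" "joined D p p'"
  shows "p \<in> points D \<and> p' \<in> points D"
  using assms(2)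
proof cases
  case (left t i e j)
  then show ?thesis
    using sized_level[OF assms(1), of t i e] by (auto simp: points_def)
next
  case (right t i e d)
  then show ?thesis
    using sized_level[OF assms(1), of t i e] by (auto simp: points_def)
next
  case (cup t i b)
  then show ?thesis
    using sized_level[OF assms(1), of t i "Cup b"] by (auto simp: points_def)
next
  case (cap t i)
  then show ?thesis
    using sized_level[OF assms(1), of t i Cap] by (auto simp: points_def)
next
  case (over_right t i)
  then show ?thesis
    using sized_level[OF assms(1), of t i "Cross True"] by (auto simp: points_def)
next
  case (over_left t i)
  then show ?thesis
    using sized_level[OF assms(1), of t i "Cross False"] by (auto simp: points_def)
qed

definition crossing_relations :: "nat \<Rightarrow> diagram \<Rightarrow> (nat \<times> nat \<Rightarrow> int) \<Rightarrow> bool" where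
  "crossing_relations k D \<phi> \<longleftrightarrow> (\<forall>t i.
     (t < length D \<and> D ! t = (i, Cross True) \<longrightarrow>
        [2 * \<phi> (t, i) = \<phi> (t, i + 1) + \<phi> (t + 1, i)] (mod int k)) \<and>
     (t < length D \<and> D ! t = (i, Cross False) \<longrightarrow>
        [2 * \<phi> (t, i + 1) = \<phi> (t, i) + \<phi> (t + 1, i + 1)] (mod int k)))"

lemma compatible_iff_joined:
  "(\<forall>t<length D. compatible k (length (level D t)) (D ! t) (\<lambda>j. \<phi> (t, j)) (\<lambda>j. \<phi> (Suc t, j)))
   \<longleftrightarrow> (\<forall>p p'. joined D p p' \<longrightarrow> \<phi> p = \<phi> p') \<and> crossing_relations k D \<phi>"
  (is "?l \<longleftrightarrow> ?r")
proof
  assume l: ?l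
  have c: "compatible k (length (level D t)) (i, e) (\<lambda>j. \<phi> (t, j)) (\<lambda>j. \<phi> (Suc t, j))"
    if "t < length D" "D ! t = (i, e)" for t i e
    using l that by metis
  have "\<phi> p = \<phi> p'" if "joined D p p'" for p p'
    using that by cases (use c in force)+
  moreover have "crossing_relations k D \<phi>"
    unfolding crossing_relations_def using c by fastforce
  ultimately show ?r by blast
next
  assume r: ?r
  show ?l
  proof (intro allI impI)
    fix t assume t: "t < length D"
    obtain i e where s: "D ! t = (i, e)" by (cases "D ! t")
    have j: "joined D p p' \<Longrightarrow> \<phi> p = \<phi> p'" for p p'
      using r by blast
    have "D ! t = (i, Cross True) \<Longrightarrow> [2 * \<phi> (t, i) = \<phi> (t, i + 1) + \<phi> (t + 1, i)] (mod int k)"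
      and "D ! t = (i, Cross False) \<Longrightarrow> [2 * \<phi> (t, i + 1) = \<phi> (t, i) + \<phi> (t + 1, i + 1)] (mod int k)"
      using r t unfolding crossing_relations_def by blast+
    then have "case e of
        Cup b \<Rightarrow> \<phi> (Suc t, i) = \<phi> (Suc t, i + 1)
      | Cap \<Rightarrow> \<phi> (t, i) = \<phi> (t, i + 1)
      | Cross s \<Rightarrow>
          if s then \<phi> (t, i) = \<phi> (Suc t, i + 1) \<and> [2 * \<phi> (t, i) = \<phi> (t, i + 1) + \<phi> (Suc t, i)] (mod int k)
          else \<phi> (t, i + 1) = \<phi> (Suc t, i) \<and> [2 * \<phi> (t, i + 1) = \<phi> (t, i) + \<phi> (Suc t, i + 1)] (mod int k)"
      using s j[OF joined.cup[OF t, of i]] j[OF joined.cap[OF t, of i]]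
        j[OF joined.over_right[OF t, of i]] j[OF joined.over_left[OF t, of i]]
      by (auto split: event.split)
    moreover have "j < i \<Longrightarrow> \<phi> (t, j) = \<phi> (Suc t, j)" for j
      using j[OF joined.left[OF t s]] by simp
    moreover have "i + strands_in e + d < length (level D t) \<Longrightarrow>
        \<phi> (t, i + strands_in e + d) = \<phi> (Suc t, i + strands_out e + d)" for d
      using j[OF joined.right[OF t s]] by simp
    ultimately show "compatible k (length (level D t)) (D ! t) (\<lambda>j. \<phi> (t, j)) (\<lambda>j. \<phi> (Suc t, j))"
      unfolding s compatible.simps by blast
  qed
qed

lemma point_colorings_iff:
  "\<phi> \<in> point_colorings k D \<longleftrightarrow> \<phi> \<in> points D \<rightarrow>\<^sub>E {0..<int k} \<and>
     (\<forall>p p'. joined D p p' \<longrightarrow> \<phi> p = \<phi> p') \<and> crossing_relations k D \<phi>"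
  unfolding point_colorings_def compatible_iff_joined by blast

lemma crossing_relations_cong:
  assumes "sized 0 D" "\<And>p. p \<in> points D \<Longrightarrow> \<phi> p = \<psi> p"
  shows "crossing_relations k D \<phi> \<longleftrightarrow> crossing_relations k D \<psi>"
proof -
  have *: "\<phi> (t, i) = \<psi> (t, i) \<and> \<phi> (t, Suc i) = \<psi> (t, Suc i) \<and>
      \<phi> (Suc t, i) = \<psi> (Suc t, i) \<and> \<phi> (Suc t, Suc i) = \<psi> (Suc t, Suc i)"
    if t: "t < length D" and c: "D ! t = (i, Cross True) \<or> D ! t = (i, Cross False)" for t i
  proof -
    obtain s where "D ! t = (i, Cross s)"
      using c by blast
    then show ?thesis
      using sized_level[OF assms(1) t] t
      by (intro conjI assms(2)) (auto simp: points_def)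
  qed
  show ?thesis
    unfolding crossing_relations_def
    by (intro iff_allI arg_cong2[where f = "(\<and>)"] imp_cong refl) (simp_all add: *)
qed

lemma arc_self: "p \<in> points D \<Longrightarrow> p \<in> arc D p"
  by (simp add: arc_def)

lemma arc_joined: "joined D p p' \<Longrightarrow> arc D p = arc D p'"
  unfolding arc_def
  by (auto intro: equivclp_trans dest: r_into_equivclp equivclp_sym)

lemma constant_on_arc:
  assumes "\<And>p p'. joined D p p' \<Longrightarrow> \<phi> p = \<phi> p'" "p' \<in> arc D p"
  shows "\<phi> p' = \<phi> p"
proof -
  have "equivclp (joined D) p p'"
    using assms(2) by (simp add: arc_def)
  then show ?thesis
    by (induction rule: equivclp_induct) (use assms(1) in metis)+
qed

lemma colorings_iff:
  "c \<in> colorings k D \<longleftrightarrow>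
     c \<in> arcs D \<rightarrow>\<^sub>E {0..<int k} \<and> crossing_relations k D (\<lambda>p. c (arc D p))"
  by (simp add: colorings_def crossing_relations_def)

text \<open>
  A function on the classes of the equivalence relation generated by \<open>joined\<close> is the same as a function
  on points that respects \<open>joined\<close>. This identification carries the Fox relations over unchanged.
\<close>

lemma bij_colorings_point_colorings:
  assumes "sized 0 D"
  shows "bij_betw (\<lambda>c. \<lambda>p\<in>points D. c (arc D p)) (colorings k D) (point_colorings k D)"
proof (rule bij_betw_byWitness[where f' = "\<lambda>\<phi>. \<lambda>A\<in>arcs D. \<phi> (SOME p. p \<in> A)"])
  have some: "(SOME p'. p' \<in> arc D p) \<in> arc D p" if "p \<in> points D" for p
    using arc_self[OF that] by (rule someI)
  have same: "arc D p' = arc D p" if "p' \<in> arc D p" for p p'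
    by (rule constant_on_arc[OF arc_joined that])
  show "\<forall>c\<in>colorings k D. (\<lambda>A\<in>arcs D. (\<lambda>p\<in>points D. c (arc D p)) (SOME p. p \<in> A)) = c"
  proof
    fix c assume c: "c \<in> colorings k D"
    have "(\<lambda>p\<in>points D. c (arc D p)) (SOME p. p \<in> A) = c A" if A: "A \<in> arcs D" for A
    proof -
      obtain p where p: "p \<in> points D" "A = arc D p"
        using A unfolding arcs_def by blast
      define q where "q = (SOME p. p \<in> A)"
      have q: "q \<in> arc D p"
        using some[OF p(1)] by (simp add: q_def p(2))
      have "arc D q = A"
        using same[OF q] p(2) by simp
      moreover have "q \<in> points D"
        using q by (simp add: arc_def)
      ultimately show ?thesis
        by (simp add: q_def[symmetric])
    qed
    moreover have "c A = undefined" if "A \<notin> arcs D" for A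
      using c that PiE_arb unfolding colorings_iff by metis
    ultimately show "(\<lambda>A\<in>arcs D. (\<lambda>p\<in>points D. c (arc D p)) (SOME p. p \<in> A)) = c"
      by (intro ext) simp
  qed
  have rep: "\<phi> (SOME p'. p' \<in> arc D p) = \<phi> p"
    if "\<phi> \<in> point_colorings k D" "p \<in> points D" for \<phi> p
  proof (rule constant_on_arc[OF _ some[OF that(2)]])
    show "\<phi> p = \<phi> p'" if "joined D p p'" for p p'
      using \<open>\<phi> \<in> point_colorings k D\<close> that unfolding point_colorings_iff by blast
  qed
  show "\<forall>\<phi>\<in>point_colorings k D.
      (\<lambda>p\<in>points D. (\<lambda>A\<in>arcs D. \<phi> (SOME p. p \<in> A)) (arc D p)) = \<phi>"
  proof
    fix \<phi> assume \<phi>: "\<phi> \<in> point_colorings k D"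
    then have "\<phi> p = undefined" if "p \<notin> points D" for p
      using that PiE_arb unfolding point_colorings_iff by metis
    then show "(\<lambda>p\<in>points D. (\<lambda>A\<in>arcs D. \<phi> (SOME p. p \<in> A)) (arc D p)) = \<phi>"
      using rep[OF \<phi>] by (intro ext) (simp add: arcs_def)
  qed
  show "(\<lambda>c. \<lambda>p\<in>points D. c (arc D p)) ` colorings k D \<subseteq> point_colorings k D"
  proof (rule image_subsetI)
    fix c assume c: "c \<in> colorings k D"
    have "crossing_relations k D (\<lambda>p\<in>points D. c (arc D p))"
      using c crossing_relations_cong[OF assms, of "\<lambda>p\<in>points D. c (arc D p)" "\<lambda>p. c (arc D p)"]
      by (simp add: colorings_iff)
    moreover have "(\<lambda>p\<in>points D. c (arc D p)) p = (\<lambda>p\<in>points D. c (arc D p)) p'"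
      if "joined D p p'" for p p'
      using joined_points[OF assms that] arc_joined[OF that] by simp
    ultimately show "(\<lambda>p\<in>points D. c (arc D p)) \<in> point_colorings k D"
      using c unfolding point_colorings_iff colorings_iff by (auto simp: arcs_def PiE_iff)
  qed
  show "(\<lambda>\<phi>. \<lambda>A\<in>arcs D. \<phi> (SOME p. p \<in> A)) ` point_colorings k D \<subseteq> colorings k D"
  proof (rule image_subsetI)
    fix \<phi> assume \<phi>: "\<phi> \<in> point_colorings k D"
    let ?c = "\<lambda>A\<in>arcs D. \<phi> (SOME p. p \<in> A)"
    have c: "?c (arc D p) = \<phi> p" if "p \<in> points D" for p
      using that rep[OF \<phi> that] by (simp add: arcs_def)
    then have "crossing_relations k D (\<lambda>p. ?c (arc D p))"
      using \<phi> crossing_relations_cong[OF assms, of "\<lambda>p. ?c (arc D p)" \<phi>]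
      by (simp add: point_colorings_iff)
    moreover have "?c \<in> arcs D \<rightarrow>\<^sub>E {0..<int k}"
    proof (rule PiE_I)
      fix A assume "A \<in> arcs D"
      then obtain p where p: "p \<in> points D" "A = arc D p"
        unfolding arcs_def by blast
      then have "?c A = \<phi> p"
        using c by simp
      then show "?c A \<in> {0..<int k}"
        using \<phi> p by (auto simp: point_colorings_iff)
    qed simp
    ultimately show "?c \<in> colorings k D"
      by (simp add: colorings_iff)
  qed
qed

text \<open>
  Regrouping the colors of the points by levels.
\<close>

lemma bij_point_colorings_paths:
  assumes "sized 0 D" "k > 0"
  shows "bij_betw (\<lambda>\<phi>. map (\<lambda>t. map (\<lambda>j. \<phi> (t, j)) [0..<length (level D t)]) [0..<Suc (length D)])
    (point_colorings k D) (paths k D [])"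
    (is "bij_betw ?f _ _")
proof (rule bij_betw_byWitness[where f' = "\<lambda>p. \<lambda>(t, j)\<in>points D. p ! t ! j"])
  have f: "?f \<phi> ! t = map (\<lambda>j. \<phi> (t, j)) [0..<length (level D t)]" if "t \<le> length D" for \<phi> t
    using that by (simp del: upt_Suc)
  have states: "p ! t \<in> states k (length (level D t))" if "p \<in> paths k D []" "t \<le> length D" for p t
    using that(2)
  proof (induction t)
    case 0
    then show ?case using that(1) by (simp add: paths_iff states_def)
  next
    case (Suc t)
    obtain i e where s: "D ! t = (i, e)" by (cases "D ! t")
    have "p ! Suc t \<in> successors k (D ! t) (p ! t)"
      using Suc.prems that(1) by (simp add: paths_iff)
    from this[unfolded s] show ?case
      using Suc sized_level[OF assms(1) _ s] successors_states[OF assms(2), of "p ! t"]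
      by simp
  qed
  have compat: "p ! Suc t \<in> successors k (D ! t) (p ! t) \<longleftrightarrow>
      compatible k (length (level D t)) (D ! t) ((!) (p ! t)) ((!) (p ! Suc t))"
    if "t < length D" "p ! t \<in> states k (length (level D t))"
      "p ! Suc t \<in> states k (length (level D (Suc t)))" for p t
  proof -
    obtain i e where s: "D ! t = (i, e)" by (cases "D ! t")
    show ?thesis
      unfolding s using that sized_level[OF assms(1) that(1) s]
      by (intro successors_iff_compatible[OF assms(2)]) auto
  qed
  have cong: "compatible k (length (level D t)) (D ! t) u v \<longleftrightarrow>
      compatible k (length (level D t)) (D ! t) u' v'"
    if "t < length D" "\<And>j. j < length (level D t) \<Longrightarrow> u j = u' j"
      "\<And>j. j < length (level D (Suc t)) \<Longrightarrow> v j = v' j" for t u v u' v'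
  proof -
    obtain i e where s: "D ! t = (i, e)" by (cases "D ! t")
    show ?thesis
      unfolding s using that sized_level[OF assms(1) that(1) s]
      by (intro compatible_cong) auto
  qed
  have range: "\<phi> (t, j) \<in> {0..<int k}"
    if "\<phi> \<in> point_colorings k D" "t \<le> length D" "j < length (level D t)" for \<phi> t j
  proof -
    have "\<phi> \<in> points D \<rightarrow>\<^sub>E {0..<int k}" "(t, j) \<in> points D"
      using that by (simp_all add: point_colorings_iff points_def)
    then show ?thesis
      by (rule PiE_mem)
  qed
  show "\<forall>\<phi>\<in>point_colorings k D. (\<lambda>(t, j)\<in>points D. ?f \<phi> ! t ! j) = \<phi>"
  proof (intro ballI ext)
    fix \<phi> and p :: "nat \<times> nat" assume \<phi>: "\<phi> \<in> point_colorings k D"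
    obtain t j where p: "p = (t, j)" by (cases p)
    show "(\<lambda>(t, j)\<in>points D. ?f \<phi> ! t ! j) p = \<phi> p"
    proof (cases "p \<in> points D")
      case True
      then have "t \<le> length D" "j < length (level D t)"
        by (simp_all add: p points_def)
      then show ?thesis
        using True f[of t \<phi>] by (simp add: p del: upt_Suc)
    next
      case False
      moreover have "\<phi> \<in> points D \<rightarrow>\<^sub>E {0..<int k}"
        using \<phi> by (simp add: point_colorings_iff)
      ultimately show ?thesis
        using PiE_arb[of \<phi> "points D" _ p] by (simp del: upt_Suc)
    qed
  qed
  show "\<forall>p\<in>paths k D []. ?f (\<lambda>(t, j)\<in>points D. p ! t ! j) = p"
  proof
    fix p assume p: "p \<in> paths k D []"
    show "?f (\<lambda>(t, j)\<in>points D. p ! t ! j) = p"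
    proof (rule nth_equalityI)
      show len: "length (?f (\<lambda>(t, j)\<in>points D. p ! t ! j)) = length p"
        using p by (simp add: paths_iff)
      fix t assume "t < length (?f (\<lambda>(t, j)\<in>points D. p ! t ! j))"
      then have t: "t \<le> length D" by simp
      show "?f (\<lambda>(t, j)\<in>points D. p ! t ! j) ! t = p ! t"
        unfolding f[OF t] using states[OF p t] t
        by (intro nth_equalityI) (simp_all add: states_def points_def)
    qed
  qed
  show "?f ` point_colorings k D \<subseteq> paths k D []"
  proof (rule image_subsetI)
    fix \<phi> assume \<phi>: "\<phi> \<in> point_colorings k D"
    have st: "?f \<phi> ! t \<in> states k (length (level D t))" if "t \<le> length D" for t
      unfolding f[OF that] states_def using range[OF \<phi> that] by auto
    have "?f \<phi> ! Suc t \<in> successors k (D ! t) (?f \<phi> ! t)" if "t < length D" for t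
    proof -
      have "compatible k (length (level D t)) (D ! t) (\<lambda>j. \<phi> (t, j)) (\<lambda>j. \<phi> (Suc t, j))"
        using \<phi> that by (simp add: point_colorings_def)
      then have "compatible k (length (level D t)) (D ! t) ((!) (?f \<phi> ! t)) ((!) (?f \<phi> ! Suc t))"
        using that by (subst cong[where u' = "\<lambda>j. \<phi> (t, j)" and v' = "\<lambda>j. \<phi> (Suc t, j)"])
          (auto simp del: upt_Suc)
      then show ?thesis
        using compat[OF that st st] that by simp
    qed
    moreover have "?f \<phi> ! 0 = []"
      by (subst f) simp_all
    ultimately show "?f \<phi> \<in> paths k D []"
      by (simp add: paths_iff del: upt_Suc)
  qed
  show "(\<lambda>p. \<lambda>(t, j)\<in>points D. p ! t ! j) ` paths k D [] \<subseteq> point_colorings k D"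
  proof (rule image_subsetI)
    fix p assume p: "p \<in> paths k D []"
    let ?\<phi> = "\<lambda>(t, j)\<in>points D. p ! t ! j"
    have "compatible k (length (level D t)) (D ! t) (\<lambda>j. ?\<phi> (t, j)) (\<lambda>j. ?\<phi> (Suc t, j))"
      if "t < length D" for t
    proof -
      have "compatible k (length (level D t)) (D ! t) ((!) (p ! t)) ((!) (p ! Suc t))"
        using compat[OF that states[OF p] states[OF p]] that p by (simp add: paths_iff)
      then show ?thesis
        using that by (subst cong[where u' = "(!) (p ! t)" and v' = "(!) (p ! Suc t)"])
          (auto simp: points_def)
    qed
    moreover have "?\<phi> \<in> points D \<rightarrow>\<^sub>E {0..<int k}"
    proof (rule PiE_I)
      fix q assume q: "q \<in> points D"
      obtain t j where tj: "q = (t, j)" by (cases q)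
      have "p ! t \<in> states k (length (level D t))" "j < length (level D t)"
        using q states[OF p] by (simp_all add: tj points_def)
      then have "p ! t ! j \<in> {0..<int k}"
        using nth_mem[of j "p ! t"] by (auto simp: states_def simp del: nth_mem)
      then show "?\<phi> q \<in> {0..<int k}"
        using q by (simp add: tj)
    qed simp
    ultimately show "?\<phi> \<in> point_colorings k D"
      by (simp add: point_colorings_def)
  qed
qed

theorem num_colorings_eq_extensions:
  assumes "sized 0 D" "k > 0"
  shows "num_colorings k D = extensions k D (\<lambda>_. 1) []"
  unfolding num_colorings_def
  using bij_betw_same_card[OF bij_colorings_point_colorings[OF assms(1)], of k]
    bij_betw_same_card[OF bij_point_colorings_paths[OF assms]] card_paths[of k D "[]"]
  by simp


section \<open>Isotopy invariance of the number of colorings\<close>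

lemma diagram_move_num_colorings:
  assumes "diagram_move D D'" "k > 0"
  shows "num_colorings k D = num_colorings k D'"
proof -
  obtain us vs A B where m: "local_move A B" "D = us @ A @ vs" "D' = us @ B @ vs"
    and l: "link_diagram D" "link_diagram D'"
    using assms(1) by (auto simp: diagram_move_def)
  note s = link_diagram_sized[OF l(1)] link_diagram_sized[OF l(2)]
  have "extensions k D (\<lambda>_. 1) [] = extensions k D' (\<lambda>_. 1) []"
    unfolding m extensions_append
  proof (rule extensions_cong[OF assms(2), where L = 0])
    fix ys assume "ys \<in> states k (width 0 us)"
    then show "extensions k A (extensions k vs (\<lambda>_. 1)) ys = extensions k B (extensions k vs (\<lambda>_. 1)) ys"
      using s m by (intro extensions_local_move[OF m(1) assms(2)]) (auto simp: sized_append)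
  qed (use s m in \<open>auto simp: sized_append states_def\<close>)
  then show ?thesis
    using s assms(2) by (simp add: num_colorings_eq_extensions)
qed

lemma link_invariant_num_colorings:
  assumes "k > 0"
  shows "link_invariant (num_colorings k)"
  unfolding link_invariant_def isotopic_def
proof (intro allI impI)
  fix D D'
  assume "link_diagram D \<and> link_diagram D' \<and> equivclp diagram_move D D'"
  then have "equivclp diagram_move D D'" by blast
  then show "num_colorings k D = num_colorings k D'"
    by (induction rule: equivclp_induct) (use diagram_move_num_colorings[OF _ assms] in metis)+
qed

section \<open>Full twists\<close>

text \<open>
  In one factor \<open>\<sigma>\<^sub>1 \<dots> \<sigma>\<^sub>w\<^sub>-\<^sub>1\<close> of the full twist, the first strand passes over all the others: it moves to
  the right end, and the other colors are reflected in its color.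
\<close>

lemma extensions_pass:
  "extensions k (map (\<lambda>j. (j, Cross True)) [length P..<length P + length ys]) F (P @ x # ys @ R)
   = F (P @ map (reflect k x) ys @ x # R)"
proof (induction ys arbitrary: P)
  case (Cons y ys)
  have "[length P..<length P + length (y # ys)] =
      length P # [length (P @ [reflect k x y])..<length (P @ [reflect k x y]) + length ys]"
    by (simp add: upt_conv_Cons del: upt_Suc)
  then show ?case
    using Cons[of "P @ [reflect k x y]"]
    by (simp add: extensions_Cons transfer_cross del: upt_Suc)
qed simp

definition alternating_partial_sum :: "int list \<Rightarrow> nat \<Rightarrow> int" where
  "alternating_partial_sum xs j = (\<Sum>i<j. (-1) ^ i * xs ! i)"

text \<open>
  The composition of the reflections in the first \<open>j\<close> colors of \<open>xs\<close>, the last one being applied first.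
\<close>

definition twist_action :: "nat \<Rightarrow> int list \<Rightarrow> nat \<Rightarrow> int \<Rightarrow> int" where
  "twist_action k xs j z = ((-1) ^ j * z + 2 * alternating_partial_sum xs j) mod int k"

text \<open>
  If \<open>g\<close> is a composition of reflections, then the reflection in \<open>g x\<close> is the conjugate by \<open>g\<close> of the
  reflection in \<open>x\<close>. Applying it after \<open>g\<close> is therefore the same as first reflecting in \<open>x\<close> and then
  applying \<open>g\<close>.
\<close>

lemma reflect_twist_action:
  "reflect k (twist_action k xs j (xs ! j)) (twist_action k xs j z) = twist_action k xs (Suc j) z"
proof -
  have "[2 * twist_action k xs j (xs ! j) - twist_action k xs j z
     = 2 * ((-1) ^ j * xs ! j + 2 * alternating_partial_sum xs j)
       - ((-1) ^ j * z + 2 * alternating_partial_sum xs j)] (mod int k)"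
    unfolding twist_action_def by (intro cong_diff cong_mult) (simp_all add: cong_def)
  also have "2 * ((-1) ^ j * xs ! j + 2 * alternating_partial_sum xs j)
       - ((-1) ^ j * z + 2 * alternating_partial_sum xs j)
     = (-1) ^ Suc j * z + 2 * alternating_partial_sum xs (Suc j)"
    by (simp add: alternating_partial_sum_def algebra_simps)
  finally show ?thesis
    unfolding reflect_def twist_action_def[of k xs "Suc j"] cong_def .
qed

lemma twist_action_range: "k > 0 \<Longrightarrow> twist_action k xs j z \<in> {0..<int k}"
  by (simp add: twist_action_def)

text \<open>
  A color is fixed by the reflection in itself, so one factor of the full twist may be described as
  reflecting all strands in the first one and then rotating. After \<open>j\<close> factors the colors are
  therefore rotated \<open>j\<close> times and transformed by one common map.
\<close>

lemma extensions_passes: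
  assumes "k > 0" "set xs \<subseteq> {0..<int k}" "j \<le> length xs"
  shows "extensions k (concat (replicate j (map (\<lambda>j. (j, Cross True))
            [length P..<length P + length xs - 1]))) F (P @ xs @ R)
       = F (P @ rotate j (map (twist_action k xs j) xs) @ R)"
  using assms(3)
proof (induction j arbitrary: F)
  case 0
  have "map (twist_action k xs 0) xs = xs"
    using assms(2) by (intro map_idI) (auto simp: twist_action_def alternating_partial_sum_def)
  then show ?case by simp
next
  case (Suc j)
  let ?B = "map (\<lambda>j. (j, Cross True)) [length P..<length P + length xs - 1]"
  define zs where "zs = rotate j (map (twist_action k xs j) xs)"
  have "xs \<noteq> []"
    using Suc.prems by auto
  then have "zs \<noteq> []"
    by (simp add: zs_def)
  then obtain z ys where zs: "zs = z # ys"
    by (cases zs) auto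
  have hd: "z = twist_action k xs j (xs ! j)"
    using zs \<open>xs \<noteq> []\<close> Suc.prems hd_rotate_conv_nth[of "map (twist_action k xs j) xs" j]
    by (auto simp: zs_def[symmetric])
  have len: "length xs = Suc (length ys)"
    using arg_cong[OF zs, of length] by (simp add: zs_def)
  have "extensions k ?B F (P @ zs @ R) = F (P @ map (reflect k z) ys @ z # R)"
    using extensions_pass[of k P ys F z R] len by (simp add: zs)
  also have "map (reflect k z) ys @ z # R = rotate1 (map (reflect k z) zs) @ R"
    using reflect_self[of z k] twist_action_range[OF assms(1)] by (simp add: zs hd)
  also have "rotate1 (map (reflect k z) zs) = rotate (Suc j) (map (reflect k z \<circ> twist_action k xs j) xs)"
    by (simp add: zs_def rotate_map rotate1_map)
  also have "reflect k z \<circ> twist_action k xs j = twist_action k xs (Suc j)"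
    by (rule ext) (simp add: hd reflect_twist_action)
  finally have "extensions k ?B F (P @ zs @ R) = F (P @ rotate (Suc j) (map (twist_action k xs (Suc j)) xs) @ R)" .
  moreover have "concat (replicate (Suc j) ?B) = concat (replicate j ?B) @ ?B"
    by (metis append_Nil2 concat.simps concat_append replicate_Suc replicate_append_same)
  ultimately show ?case
    using Suc by (simp add: extensions_append zs_def del: replicate_Suc)
qed

text \<open>
  After \<open>w\<close> factors the rotation is the identity. A composition of an even number of reflections is
  a translation, here by twice the alternating sum of the colors.
\<close>

lemma extensions_full_twist:
  assumes "k > 0" "set xs \<subseteq> {0..<int k}" "even (length xs)"
  shows "extensions k (full_twist (length P) (length xs)) F (P @ xs @ R)
    = F (P @ map (\<lambda>z. (z + 2 * alternating_partial_sum xs (length xs)) mod int k) xs @ R)"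
proof -
  have "twist_action k xs (length xs) = (\<lambda>z. (z + 2 * alternating_partial_sum xs (length xs)) mod int k)"
    using assms(3) by (intro ext) (simp add: twist_action_def)
  then show ?thesis
    using extensions_passes[OF assms(1,2), of "length xs" P F R]
    by (simp add: full_twist_def)
qed

lemma sum_alternating_signs: "even w \<Longrightarrow> (\<Sum>i<w. (-1) ^ i :: int) = 0"
proof (induction w rule: less_induct)
  case (less w)
  show ?case
  proof (cases w)
    case (Suc v)
    then obtain u where "w = Suc (Suc u)"
      using less.prems by (cases v) auto
    then show ?thesis
      using less by simp
  qed simp
qed

text \<open>
  On an even number of strands a common translation cancels in the alternating sum. So successive full
  twists translate by the same amount.
\<close>

lemma alternating_partial_sum_translate:
  assumes "even (length xs)"
  shows "[alternating_partial_sum (map (\<lambda>z. (z + c) mod int k) xs) (length xs)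
    = alternating_partial_sum xs (length xs)] (mod int k)"
proof -
  have "[alternating_partial_sum (map (\<lambda>z. (z + c) mod int k) xs) (length xs)
    = (\<Sum>i<length xs. (-1) ^ i * (xs ! i + c))] (mod int k)"
    unfolding alternating_partial_sum_def
    by (intro cong_sum cong_mult) (auto simp: cong_def)
  also have "(\<Sum>i<length xs. (-1) ^ i * (xs ! i + c))
      = alternating_partial_sum xs (length xs) + (\<Sum>i<length xs. (-1) ^ i) * c"
    by (simp add: alternating_partial_sum_def algebra_simps sum.distrib sum_distrib_left)
  finally show ?thesis
    by (simp add: sum_alternating_signs[OF assms])
qed

lemma extensions_full_twists:
  assumes "k > 0" "set xs \<subseteq> {0..<int k}" "even (length xs)"
  shows "extensions k (concat (replicate n (full_twist (length P) (length xs)))) F (P @ xs @ R)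
    = F (P @ map (\<lambda>z. (z + 2 * int n * alternating_partial_sum xs (length xs)) mod int k) xs @ R)"
proof (induction n arbitrary: F)
  case 0
  have "map (\<lambda>z. z mod int k) xs = xs"
    using assms(2) by (intro map_idI) auto
  then show ?case by simp
next
  case (Suc n)
  let ?T = "full_twist (length P) (length xs)"
  let ?s = "alternating_partial_sum xs (length xs)"
  let ?c = "2 * int n * ?s"
  define ys where "ys = map (\<lambda>z. (z + ?c) mod int k) xs"
  have ys: "length ys = length xs" "set ys \<subseteq> {0..<int k}"
    using assms(1) by (auto simp: ys_def)
  have s: "[alternating_partial_sum ys (length ys) = ?s] (mod int k)"
    unfolding ys(1) unfolding ys_def by (rule alternating_partial_sum_translate[OF assms(3)])
  have "(y + 2 * alternating_partial_sum ys (length ys)) mod int k = (z + 2 * int (Suc n) * ?s) mod int k"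
    if "y = (z + ?c) mod int k" for y z
  proof -
    have "[y + 2 * alternating_partial_sum ys (length ys) = (z + ?c) + 2 * ?s] (mod int k)"
      using that by (intro cong_add cong_mult s) (simp_all add: cong_def)
    also have "(z + ?c) + 2 * ?s = z + 2 * int (Suc n) * ?s"
      by (simp add: algebra_simps)
    finally show ?thesis
      by (simp add: cong_def)
  qed
  then have "map (\<lambda>z. (z + 2 * alternating_partial_sum ys (length ys)) mod int k) ys
     = map (\<lambda>z. (z + 2 * int (Suc n) * ?s) mod int k) xs"
    by (simp add: ys_def)
  moreover have "concat (replicate (Suc n) ?T) = concat (replicate n ?T) @ ?T"
    by (metis append_Nil2 concat.simps concat_append replicate_Suc replicate_append_same)
  moreover have "extensions k ?T F (P @ ys @ R)
     = F (P @ map (\<lambda>z. (z + 2 * alternating_partial_sum ys (length ys)) mod int k) ys @ R)"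
    using extensions_full_twist[OF assms(1) ys(2), of P F R] assms(3) ys(1) by simp
  ultimately show ?case
    using Suc by (simp add: extensions_append ys_def[symmetric] del: replicate_Suc)
qed

text \<open>
  The \<open>n\<close> full twists translate all colors by \<open>2 * n\<close> times the alternating sum, which vanishes modulo
  \<open>2 * n\<close>.
\<close>

lemma extensions_twists_trivial:
  assumes "n \<ge> 1" "even w" "i + w \<le> L" "xs \<in> states (2 * n) L"
  shows "extensions (2 * n) (concat (replicate n (full_twist i w))) F xs = F xs"
proof -
  obtain P M R where xs: "xs = P @ M @ R" "length P = i" "length M = w" "set M \<subseteq> {0..<int (2 * n)}"
    using assms(4,3) by (rule split_state)
  have "map (\<lambda>z. (z + 2 * int n * alternating_partial_sum M (length M)) mod int (2 * n)) M = M"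
    using xs(4) by (intro map_idI) (auto simp: subset_eq)
  then show ?thesis
    using extensions_full_twists[of "2 * n" M n P F R] xs assms by simp
qed

lemma crossings_sized:
  assumes "\<And>i e. (i, e) \<in> set D \<Longrightarrow> i + 2 \<le> L \<and> (\<exists>s. e = Cross s)"
  shows "sized L D \<and> width L D = L"
  using assms
proof (induction D)
  case (Cons s D)
  obtain i e where s: "s = (i, e)" by (cases s)
  then obtain b where b: "e = Cross b" "i + 2 \<le> L"
    using Cons.prems by auto
  moreover have "sized L D \<and> width L D = L"
    using Cons by auto
  moreover have "L - 2 + 2 = L"
    using b(2) by simp
  ultimately show ?case
    using s b by (simp del: add_2_eq_Suc')
qed simp

lemma twists_sized:
  assumes "i + w \<le> L"
  shows "sized L (concat (replicate n (full_twist i w))) \<and>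
    width L (concat (replicate n (full_twist i w))) = L"
proof (rule crossings_sized)
  fix j e assume "(j, e) \<in> set (concat (replicate n (full_twist i w)))"
  then have "e = Cross True \<and> j < i + w - 1"
    by (auto simp: full_twist_def split: if_splits)
  then show "j + 2 \<le> L \<and> (\<exists>s. e = Cross s)"
    using assms by auto
qed

lemma twist_invariance:
  assumes "n \<ge> 1" "even w" "i + w \<le> width 0 U" "sized 0 (U @ V)"
  shows "num_colorings (2 * n) (U @ concat (replicate n (full_twist i w)) @ V) = num_colorings (2 * n) (U @ V)"
proof -
  let ?T = "concat (replicate n (full_twist i w))"
  have "sized 0 (U @ ?T @ V)"
    using assms(4) twists_sized[OF assms(3), of n] by (simp add: sized_append width_append)
  moreover have "extensions (2 * n) (U @ ?T @ V) F [] = extensions (2 * n) (U @ V) F []" for F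
    unfolding extensions_append using assms
    by (intro extensions_cong[where L = 0] extensions_twists_trivial)
      (auto simp: sized_append states_def)
  ultimately show ?thesis
    using assms by (simp add: num_colorings_eq_extensions)
qed

lemma twisted_one_disk:
  assumes "disks E = {p}"
  obtains i w U V where "E ! p = Disk i w" "p < length E" "underlying (take p E) = U"
    "underlying E = U @ V" "\<forall>n. twisted n {} E = U @ V"
    "\<forall>n. twisted n {p} E = U @ concat (replicate n (full_twist i w)) @ V"
proof -
  have p: "p < length E" and "\<exists>i w. E ! p = Disk i w"
    using assms by (auto simp: disks_def)
  then obtain i w where d: "E ! p = Disk i w" by blast
  have slices: "\<exists>x. E ! q = Slice x" if "q < length E" "q \<noteq> p" for q
    using that assms by (cases "E ! q") (auto simp: disks_def)
  have indep: "twist_piece n on (E ! q) = twist_piece 0 False (E ! q)"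
    if "q < length E" "q \<noteq> p" for n on q
    using slices[OF that] by auto
  define U where "U = concat (map (\<lambda>q. twist_piece 0 False (E ! q)) [0..<p])"
  define V where "V = concat (map (\<lambda>q. twist_piece 0 False (E ! q)) [Suc p..<length E])"
  have split: "[0..<length E] = [0..<p] @ p # [Suc p..<length E]"
    using p upt_add_eq_append[of 0 p "length E - p"] by (simp add: upt_conv_Cons)
  have tw: "twisted n S E = U @ twist_piece n (p \<in> S) (E ! p) @ V" for n S
  proof -
    have "map (\<lambda>q. twist_piece n (q \<in> S) (E ! q)) [0..<p] = map (\<lambda>q. twist_piece 0 False (E ! q)) [0..<p]"
      and "map (\<lambda>q. twist_piece n (q \<in> S) (E ! q)) [Suc p..<length E]
        = map (\<lambda>q. twist_piece 0 False (E ! q)) [Suc p..<length E]"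
      using p by (auto intro!: indep)
    then show ?thesis
      unfolding twisted_def split map_append list.map concat_append concat.simps U_def V_def
      by (simp only:)
  qed
  show ?thesis
  proof
    show "underlying (take p E) = U"
      unfolding underlying_def twisted_def U_def
      by (rule arg_cong[where f = concat]) (use p in auto)
  qed (use d p tw in \<open>auto simp: underlying_def\<close>)
qed

text \<open>
  The linking number is a sum of \<open>w\<close> signs, hence congruent to \<open>w\<close> modulo 2; for \<open>q = 0\<close> the assumption
  says that it is 0.
\<close>

lemma even_disk_lk:
  assumes "E ! p = Disk i w" "[disk_lk E p = 0] (mod int q)" "even q"
  shows "even w"
proof -
  let ?s = "\<lambda>j. if disk_level E p ! j then 1 else - 1 :: int"
  have "int q dvd disk_lk E p" "even (int q)"
    using assms(2,3) by (simp_all add: cong_0_iff)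
  then have "even (disk_lk E p)"
    using dvd_trans by blast
  moreover have "disk_lk E p = (\<Sum>j\<in>{i..<i + w}. ?s j)"
    using assms(1) by (simp add: disk_lk_def)
  moreover have "even ((\<Sum>j\<in>A. ?s j) - int (card A))" if "finite A" for A
    using that by (induction A) auto
  from this[of "{i..<i + w}"] have "even ((\<Sum>j\<in>{i..<i + w}. ?s j) - int w)"
    by simp
  ultimately show ?thesis
    by simp
qed

lemma nq_finite_num_colorings:
  assumes "n \<ge> 1" "even q"
  shows "nq_finite_order_le n q 0 (\<lambda>D. int (num_colorings (2 * n) D))"
  unfolding nq_finite_order_le_def
proof (intro conjI allI impI)
  show "link_invariant (\<lambda>D. int (num_colorings (2 * n) D))"
    using link_invariant_num_colorings[of "2 * n"] assms(1) by (simp add: link_invariant_def)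
next
  fix E
  assume E: "link_with_disks E \<and> card (disks E) = 0 + 1 \<and> (\<forall>p\<in>disks E. [disk_lk E p = 0] (mod int q))"
  then obtain p where p: "disks E = {p}"
    by (auto simp: card_1_singleton_iff)
  obtain i w U V where d: "E ! p = Disk i w" "p < length E" "underlying (take p E) = U"
    "underlying E = U @ V" "\<forall>n. twisted n {} E = U @ V"
    "\<forall>n. twisted n {p} E = U @ concat (replicate n (full_twist i w)) @ V"
    by (rule twisted_one_disk[OF p])
  have s: "sized 0 (U @ V)"
    using E d(4) link_diagram_sized by (auto simp: link_with_disks_def)
  have "disk_level E p = level (U @ V) (length U)"
    using d(3) by (simp add: disk_level_def level_def)
  then have "length (disk_level E p) = width 0 U"
    using width_level[OF s, of "length U"] by simp
  moreover have "i + w \<le> length (disk_level E p)"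
    using E d(1,2) unfolding link_with_disks_def by blast
  ultimately have "i + w \<le> width 0 U"
    by simp
  moreover have "even w"
    using even_disk_lk[OF d(1) _ assms(2)] E p by simp
  ultimately have "num_colorings (2 * n) (twisted n {p} E) = num_colorings (2 * n) (twisted n {} E)"
    unfolding d(5,6)[rule_format] using s by (intro twist_invariance[OF assms(1)])
  then show "alternating_sum (disks E) (\<lambda>S. int (num_colorings (2 * n) (twisted n S E))) = 0"
    by (simp add: p alternating_sum_def Pow_insert)
qed


section \<open>Closed 2-braids\<close>

definition braid_closure :: "bool list \<Rightarrow> diagram" where
  "braid_closure ss =
     [(0, Cup True), (1, Cup True)] @ map (\<lambda>s. (0, Cross s)) ss @ [(1, Cap), (0, Cap)]"

text \<open>
  The exponent of the 2-braid, which is the sum of the signs of its crossings since both strands point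
  upwards.
\<close>

definition writhe :: "bool list \<Rightarrow> int" where
  "writhe ss = (\<Sum>s\<leftarrow>ss. if s then 1 else - 1)"

lemma link_diagram_braid_closure: "link_diagram (braid_closure ss)"
proof -
  let ?B = "map (\<lambda>s. (0, Cross s)) ss"
  have b: "foldl step [True, True, False, False] (map (\<lambda>s. (0, Cross s)) rs) = [True, True, False, False]" for rs
    by (induction rs) auto
  have level: "level (braid_closure ss) t = [True, True, False, False]"
    if "t \<ge> 2" "t \<le> length ss + 2" for t
  proof -
    have "take t (braid_closure ss) = [(0, Cup True), (1, Cup True)] @ map (\<lambda>s. (0, Cross s)) (take (t - 2) ss)"
      using that by (simp add: braid_closure_def take_Cons' take_map numeral_2_eq_2)
    then show ?thesis
      by (simp add: level_def b)
  qed
  have "fits (level (braid_closure ss) t) (braid_closure ss ! t)" if t: "t < length ss + 4" for t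
  proof -
    consider "t = 0" | "t = 1" | "t \<ge> 2" "t < length ss + 2" | "t = length ss + 2" | "t = length ss + 3"
      using t by linarith
    then show ?thesis
    proof cases
      case 3
      then have "braid_closure ss ! t = (0, Cross (ss ! (t - 2)))"
        by (auto simp: braid_closure_def nth_Cons' nth_append numeral_2_eq_2)
      then show ?thesis
        using 3 by (simp add: level)
    next
      case 4
      then have "braid_closure ss ! t = (1, Cap)"
        by (simp add: braid_closure_def nth_append)
      then show ?thesis
        using 4 level[of t] by simp
    next
      case 5
      then have "braid_closure ss ! t = (0, Cap)" "take t (braid_closure ss) =
          [(0, Cup True), (1, Cup True)] @ ?B @ [(1, Cap)]"
        by (simp_all add: braid_closure_def nth_append eval_nat_numeral)
      then show ?thesis
        by (simp add: level_def b)
    qed (simp_all add: braid_closure_def level_def)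
  qed
  moreover have "level (braid_closure ss) (length ss + 4) = []"
    by (simp add: level_def braid_closure_def b)
  moreover have "length (braid_closure ss) = length ss + 4"
    by (simp add: braid_closure_def)
  ultimately show ?thesis
    by (simp add: link_diagram_def)
qed

text \<open>
  A crossing shifts both colors by their difference, up or down according to its sign, and thereby
  keeps the difference. Only the writhe matters.
\<close>

lemma extensions_two_braid:
  assumes "k > 0"
  shows "extensions k (map (\<lambda>s. (0, Cross s)) ss) F (x mod int k # y mod int k # R)
    = F ((x + writhe ss * (x - y)) mod int k # (y + writhe ss * (x - y)) mod int k # R)"
proof (induction ss arbitrary: x y)
  case Nil
  then show ?case by (simp add: writhe_def)
next
  case (Cons s ss)
  have r: "reflect k (u mod int k) (v mod int k) = (2 * u - v) mod int k" for u v
  proof -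
    have "[2 * (u mod int k) - v mod int k = 2 * u - v] (mod int k)"
      by (intro cong_diff cong_mult) simp_all
    then show ?thesis
      by (simp add: reflect_def cong_def)
  qed
  have w: "writhe (s # ss) = writhe ss + (if s then 1 else - 1)" for s
    by (simp add: writhe_def)
  show ?case
  proof (cases s)
    case True
    have "extensions k (map (\<lambda>s. (0, Cross s)) (s # ss)) F (x mod int k # y mod int k # R)
      = extensions k (map (\<lambda>s. (0, Cross s)) ss) F ((2 * x - y) mod int k # x mod int k # R)"
      using transfer_cross[of "[]" 0 k s] True by (simp add: extensions_Cons r)
    then show ?thesis
      by (simp add: Cons.IH w True algebra_simps)
  next
    case False
    have "extensions k (map (\<lambda>s. (0, Cross s)) (s # ss)) F (x mod int k # y mod int k # R)
      = extensions k (map (\<lambda>s. (0, Cross s)) ss) F (y mod int k # (2 * y - x) mod int k # R)"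
      using transfer_cross[of "[]" 0 k s] False by (simp add: extensions_Cons r)
    then show ?thesis
      by (simp add: Cons.IH w False algebra_simps)
  qed
qed

text \<open>
  The two cups choose the colors \<open>x\<close> and \<open>y\<close>, and the two caps ask that the braid returns them.
\<close>

lemma num_colorings_braid_closure:
  assumes "k > 0"
  shows "num_colorings k (braid_closure ss) =
    card {(x, y). x \<in> {0..<int k} \<and> y \<in> {0..<int k} \<and> int k dvd writhe ss * (x - y)}"
proof -
  let ?K = "{0..<int k}"
  have caps: "extensions k [(1, Cap), (0, Cap)] (\<lambda>_. 1) [u, v, y, x] = (if v = y \<and> u = x then 1 else 0)"
    for u v x y
  proof -
    have "transfer k (0, Cap) F [a, b] = (if a = b then F [] else 0)" for F a b
      using transfer_cap[of "[]" 0 k F a b "[]"] by simp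
    then show ?thesis
      using transfer_cap[of "[u]" 1 k _ v y "[x]"] by (simp add: extensions_Cons)
  qed
  have fixed: "(x + writhe ss * (x - y)) mod int k = x \<longleftrightarrow> int k dvd writhe ss * (x - y)"
    "(y + writhe ss * (x - y)) mod int k = y \<longleftrightarrow> int k dvd writhe ss * (x - y)"
    if "x \<in> ?K" "y \<in> ?K" for x y
  proof -
    have "(z + d) mod int k = z \<longleftrightarrow> int k dvd d" if "z \<in> ?K" for z d
    proof -
      have "(z + d) mod int k = z \<longleftrightarrow> (z + d) mod int k = z mod int k"
        using that by simp
      then show ?thesis
        by (simp add: mod_eq_dvd_iff)
    qed
    then show "(x + writhe ss * (x - y)) mod int k = x \<longleftrightarrow> int k dvd writhe ss * (x - y)"
      "(y + writhe ss * (x - y)) mod int k = y \<longleftrightarrow> int k dvd writhe ss * (x - y)"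
      using that by auto
  qed
  have braid: "extensions k (map (\<lambda>s. (0, Cross s)) ss @ [(1, Cap), (0, Cap)]) (\<lambda>_. 1) [x, y, y, x]
      = (if int k dvd writhe ss * (x - y) then 1 else 0)" if "x \<in> ?K" "y \<in> ?K" for x y
    using extensions_two_braid[OF assms, of ss _ x y "[y, x]"] that fixed[OF that]
    by (simp add: extensions_append caps[simplified])
  have "extensions k (braid_closure ss) (\<lambda>_. 1) [] = (\<Sum>x\<in>?K. \<Sum>y\<in>?K.
      extensions k (map (\<lambda>s. (0, Cross s)) ss @ [(1, Cap), (0, Cap)]) (\<lambda>_. 1) [x, y, y, x])"
    unfolding braid_closure_def append.simps extensions_Cons
    using transfer_cup[of "[]" 0 k True _ "[]"] transfer_cup[of "[x]" 1 k True _ "[x]" for x]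
    by simp
  also have "\<dots> = (\<Sum>x\<in>?K. \<Sum>y\<in>?K. if int k dvd writhe ss * (x - y) then 1 else 0)"
    by (intro sum.cong refl) (simp add: braid[simplified])
  also have "\<dots> = (\<Sum>(x, y)\<in>?K \<times> ?K. if int k dvd writhe ss * (x - y) then 1 else 0)"
    by (simp add: sum.cartesian_product)
  also have "\<dots> = card {p \<in> ?K \<times> ?K. int k dvd writhe ss * (fst p - snd p)}"
    by (simp add: sum.If_cases case_prod_beta Int_def)
  also have "{p \<in> ?K \<times> ?K. int k dvd writhe ss * (fst p - snd p)}
      = {(x, y). x \<in> ?K \<and> y \<in> ?K \<and> int k dvd writhe ss * (x - y)}"
    by auto
  finally show ?thesis
    using num_colorings_eq_extensions[OF link_diagram_sized[OF link_diagram_braid_closure] assms]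
    by simp
qed

text \<open>
  The number of \<open>k\<close>-colorings of the torus link \<open>T(2, e)\<close>.
\<close>

definition torus_count :: "nat \<Rightarrow> int \<Rightarrow> nat" where
  "torus_count k e = card {(x, y). x \<in> {0..<int k} \<and> y \<in> {0..<int k} \<and> int k dvd e * (x - y)}"

lemma torus_count_periodic: "torus_count k (e + int k) = torus_count k e"
proof -
  have "int k dvd (e + int k) * z \<longleftrightarrow> int k dvd e * z" for z
    using dvd_add_left_iff[of "int k" "int k * z" "e * z"] by (simp add: distrib_right)
  then show ?thesis
    by (simp add: torus_count_def)
qed

lemma torus_count_2_less:
  assumes "k > 2"
  shows "torus_count k 2 < torus_count k 0"
  unfolding torus_count_def
proof (rule psubset_card_mono)
  have "{(x, y). x \<in> {0..<int k} \<and> y \<in> {0..<int k} \<and> int k dvd 0 * (x - y)}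
      = {0..<int k} \<times> {0..<int k}"
    by auto
  then show "finite {(x, y). x \<in> {0..<int k} \<and> y \<in> {0..<int k} \<and> int k dvd 0 * (x - y)}"
    by simp
  have "\<not> int k dvd 2 * (1 - 0)"
    using assms zdvd_imp_le[of "int k" 2] by auto
  then have "(1, 0) \<notin> {(x, y). x \<in> {0..<int k} \<and> y \<in> {0..<int k} \<and> int k dvd 2 * (x - y)}"
    by simp
  moreover have "(1, 0) \<in> {(x, y). x \<in> {0..<int k} \<and> y \<in> {0..<int k} \<and> int k dvd 0 * (x - y)}"
    using assms by simp
  moreover have "{(x, y). x \<in> {0..<int k} \<and> y \<in> {0..<int k} \<and> int k dvd 2 * (x - y)}
      \<subseteq> {(x, y). x \<in> {0..<int k} \<and> y \<in> {0..<int k} \<and> int k dvd 0 * (x - y)}"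
    by auto
  ultimately show "{(x, y). x \<in> {0..<int k} \<and> y \<in> {0..<int k} \<and> int k dvd 2 * (x - y)}
      \<subset> {(x, y). x \<in> {0..<int k} \<and> y \<in> {0..<int k} \<and> int k dvd 0 * (x - y)}"
    by blast
qed

section \<open>Finite differences\<close>

definition difference :: "(nat \<Rightarrow> int) \<Rightarrow> nat \<Rightarrow> int" where
  "difference h x = h (Suc x) - h x"

lemma alternating_sum_insert:
  assumes "finite A" "a \<notin> A"
  shows "alternating_sum (insert a A) g = alternating_sum A g - alternating_sum A (\<lambda>S. g (insert a S))"
proof -
  let ?s = "\<lambda>S. if even (card S) then g S else - g S"
  have "alternating_sum (insert a A) g = sum ?s (Pow A) + sum ?s (insert a ` Pow A)"
    unfolding alternating_sum_def Pow_insert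
    using assms by (intro sum.union_disjoint) auto
  also have "sum ?s (insert a ` Pow A) = (\<Sum>S\<in>Pow A. ?s (insert a S))"
    using assms(2) by (subst sum.reindex) (auto simp: inj_on_def)
  also have "\<dots> = (\<Sum>S\<in>Pow A. - (if even (card S) then g (insert a S) else - g (insert a S)))"
  proof (rule sum.cong)
    fix S assume "S \<in> Pow A"
    then have "card (insert a S) = Suc (card S)"
      using assms by (intro card_insert_disjoint) (auto dest: finite_subset)
    then show "?s (insert a S) = - (if even (card S) then g (insert a S) else - g (insert a S))"
      by simp
  qed simp
  finally show ?thesis
    by (simp add: alternating_sum_def sum_negf)
qed

lemma alternating_sum_cong:
  "(\<And>S. S \<subseteq> A \<Longrightarrow> g S = g' S) \<Longrightarrow> alternating_sum A g = alternating_sum A g'"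
  by (auto simp: alternating_sum_def intro!: sum.cong)

text \<open>
  Each element of \<open>A\<close> contributes one difference: leaving it out of \<open>S\<close> raises the argument by one.
\<close>

lemma alternating_sum_difference:
  assumes "finite A"
  shows "alternating_sum A (\<lambda>S. h (x + card A - card S)) = (difference ^^ card A) h x"
  using assms
proof (induction A arbitrary: x rule: finite_induct)
  case empty
  then show ?case by (simp add: alternating_sum_def)
next
  case (insert a A)
  have "alternating_sum (insert a A) (\<lambda>S. h (x + card (insert a A) - card S))
      = alternating_sum A (\<lambda>S. h (Suc x + card A - card S)) - alternating_sum A (\<lambda>S. h (x + card A - card S))"
    unfolding alternating_sum_insert[OF insert.hyps]
  proof (intro arg_cong2[where f = "(-)"] alternating_sum_cong)
    fix S assume S: "S \<subseteq> A"
    then have "finite S" "a \<notin> S"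
      using insert.hyps finite_subset by auto
    then show "h (x + card (insert a A) - card (insert a S)) = h (x + card A - card S)"
      using insert.hyps by simp
  qed (use insert.hyps in simp)
  then show ?case
    unfolding insert.IH using insert.hyps
    by (simp add: difference_def[of "(difference ^^ card A) h" x])
qed

text \<open>
  A function with a vanishing iterated difference is a polynomial, and a nonconstant polynomial is
  unbounded. By induction, the first difference, again periodic, is constant; over a period it adds up
  to 0.
\<close>

lemma periodic_polynomial_constant:
  assumes "n > 0" "\<And>x. h (x + n) = h x" "\<And>x. (difference ^^ Suc m) h x = 0"
  shows "h (Suc x) = h x"
  using assms(2,3)
proof (induction m arbitrary: h x)
  case 0
  then show ?case by (simp add: difference_def)
next
  case (Suc m)
  have "difference h (Suc y) = difference h y" for y
  proof (rule Suc.IH)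
    show "difference h (x + n) = difference h x" for x
      using Suc.prems(1)[of x] Suc.prems(1)[of "Suc x"] by (simp add: difference_def)
    show "(difference ^^ Suc m) (difference h) x = 0" for x
      using Suc.prems(2)[of x] by (simp add: funpow_swap1)
  qed
  then have d: "difference h y = difference h 0" for y
    by (induction y) simp_all
  have "h y = h 0 + int y * difference h 0" for y
  proof (induction y)
    case (Suc y)
    then show ?case
      using d[of y] by (simp add: difference_def[of h y] algebra_simps)
  qed simp
  from this[of n] have "difference h 0 = 0"
    using Suc.prems(1)[of 0] assms(1) by simp
  then show ?case
    using d[of x] by (simp add: difference_def)
qed

lemma writhe_change:
  "writhe (map (\<lambda>t. t \<notin> S) [0..<N]) = int N - 2 * int (card (S \<inter> {..<N}))"
proof -
  have "writhe (map (\<lambda>t. t \<notin> S) [0..<N]) = (\<Sum>t<N. if t \<notin> S then 1 else - 1)"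
    unfolding writhe_def map_map comp_def
    by (simp add: interv_sum_list_conv_sum_set_nat atLeast0LessThan)
  also have "\<dots> = (\<Sum>t<N. 1 - 2 * (if t \<in> S then 1 else 0))"
    by (intro sum.cong) auto
  also have "\<dots> = int N - 2 * int (card (S \<inter> {..<N}))"
    by (simp add: sum_subtractf sum_distrib_left[symmetric] sum.If_cases Int_commute)
  finally show ?thesis .
qed

lemma change_crossings_braid_closure:
  assumes "S \<subseteq> {2..<N + 2}"
  shows "change_crossings S (braid_closure (replicate N True))
    = braid_closure (map (\<lambda>t. t + 2 \<notin> S) [0..<N])"
proof (rule nth_equalityI)
  show "length (change_crossings S (braid_closure (replicate N True)))
    = length (braid_closure (map (\<lambda>t. t + 2 \<notin> S) [0..<N]))"
    by (simp add: change_crossings_def braid_closure_def)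
  fix t assume "t < length (change_crossings S (braid_closure (replicate N True)))"
  then have t: "t < N + 4"
    by (simp add: change_crossings_def braid_closure_def)
  then have c: "change_crossings S (braid_closure (replicate N True)) ! t =
    (if t \<in> S then switch (braid_closure (replicate N True) ! t) else braid_closure (replicate N True) ! t)"
    by (simp add: change_crossings_def braid_closure_def del: upt_Suc)
  consider "t < 2" | "t \<ge> 2" "t < N + 2" | "t \<ge> N + 2"
    by linarith
  then show "change_crossings S (braid_closure (replicate N True)) ! t
    = braid_closure (map (\<lambda>t. t + 2 \<notin> S) [0..<N]) ! t"
  proof cases
    case 2
    then have "t - 2 < N" "Suc (Suc (t - 2)) = t" by auto
    with 2 show ?thesis
      unfolding c by (auto simp: braid_closure_def nth_Cons' nth_append numeral_2_eq_2)
  next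
    case 1
    then show ?thesis
      unfolding c using assms by (auto simp: braid_closure_def nth_Cons' nth_append)
  next
    case 3
    then have "t \<notin> S" using assms by auto
    then show ?thesis
      unfolding c using 3 by (auto simp: braid_closure_def nth_Cons' nth_append)
  qed
qed

text \<open>
  Switching a crossing of a closed 2-braid lowers its writhe by 2. If the coloring number were of finite
  type, it would thus be a polynomial in half the writhe along the torus links of even writhe. Being
  periodic it would be constant, but the unlink, of writhe 0, has more colorings than the Hopf link,
  of writhe 2.
\<close>

lemma not_finite_type_num_colorings:
  assumes "k > 2" "even k"
  shows "\<not> finite_type (\<lambda>D. int (num_colorings k D))"
proof
  assume "finite_type (\<lambda>D. int (num_colorings k D))"
  then obtain m where m: "\<And>D A. link_diagram D \<Longrightarrow> A \<subseteq> crossings D \<Longrightarrow> card A = Suc m \<Longrightarrow>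
      alternating_sum A (\<lambda>S. int (num_colorings k (change_crossings S D))) = 0"
    unfolding finite_type_def finite_type_order_le_def by (metis Suc_eq_plus1)
  define h where "h x = int (torus_count k (2 * int x))" for x :: nat
  have "(difference ^^ Suc m) h x = 0" for x
  proof -
    \<comment> \<open>Switching \<open>s\<close> of the \<open>N\<close> crossings leaves the writhe \<open>N - 2 * s = 2 * (x + Suc m - s)\<close>.\<close>
    define N where "N = 2 * x + 2 * Suc m"
    define A where "A = {2..<Suc m + 2}"
    have A: "card A = Suc m" "finite A"
      by (simp_all add: A_def)
    have "A \<subseteq> crossings (braid_closure (replicate N True))"
      by (auto simp: A_def N_def crossings_def braid_closure_def nth_Cons' nth_append)
    then have "alternating_sum A (\<lambda>S. int (num_colorings k
        (change_crossings S (braid_closure (replicate N True))))) = 0"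
      using m A link_diagram_braid_closure by blast
    moreover have "int (num_colorings k (change_crossings S (braid_closure (replicate N True))))
        = h (x + card A - card S)" if S: "S \<subseteq> A" for S
    proof -
      have fin: "finite S" "card S \<le> card A"
        using finite_subset[OF S A(2)] card_mono[OF A(2) S] by auto
      have sub: "S \<subseteq> {2..<N + 2}"
        using S by (auto simp: A_def N_def)
      have "card ((\<lambda>t. t - 2) ` S \<inter> {..<N}) = card S"
      proof -
        have "(\<lambda>t. t - 2) ` S \<inter> {..<N} = (\<lambda>t. t - 2) ` S"
          using sub by force
        moreover have "inj_on (\<lambda>t. t - 2) S"
        proof (rule inj_onI)
          fix t u assume "t \<in> S" "u \<in> S" and eq: "t - 2 = u - 2"
          then have "2 \<le> t" "2 \<le> u"
            using sub by auto
          then show "t = u"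
            using eq by simp
        qed
        ultimately show ?thesis
          by (simp add: card_image)
      qed
      moreover have "t + 2 \<in> S \<longleftrightarrow> t \<in> (\<lambda>t. t - 2) ` S" for t
      proof
        assume "t + 2 \<in> S"
        then have "t + 2 - 2 \<in> (\<lambda>t. t - 2) ` S"
          by (rule imageI)
        then show "t \<in> (\<lambda>t. t - 2) ` S"
          by simp
      next
        assume "t \<in> (\<lambda>t. t - 2) ` S"
        then obtain u where u: "u \<in> S" "t = u - 2"
          by blast
        moreover from u(1) have "2 \<le> u"
          using sub by auto
        ultimately have "t + 2 = u"
          by simp
        then show "t + 2 \<in> S"
          using u by simp
      qed
      ultimately have "writhe (map (\<lambda>t. t + 2 \<notin> S) [0..<N]) = int N - 2 * int (card S)"
        using writhe_change[of "(\<lambda>t. t - 2) ` S" N] by (simp del: add_2_eq_Suc')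
      also have "\<dots> = 2 * int (x + card A - card S)"
        using fin A by (simp add: N_def of_nat_diff)
      finally have "writhe (map (\<lambda>t. t + 2 \<notin> S) [0..<N]) = 2 * int (x + card A - card S)" .
      then show ?thesis
        using num_colorings_braid_closure[of k "map (\<lambda>t. t + 2 \<notin> S) [0..<N]"] assms(1)
        by (simp add: change_crossings_braid_closure[OF sub] h_def torus_count_def)
    qed
    ultimately show ?thesis
      using alternating_sum_difference[OF A(2), of h x] A(1)
        alternating_sum_cong[of A "\<lambda>S. int (num_colorings k
          (change_crossings S (braid_closure (replicate N True))))" "\<lambda>S. h (x + card A - card S)"]
      by simp
  qed
  moreover have "h (x + k div 2) = h x" for x
    using torus_count_periodic[of k "2 * int x"] assms(2) by (auto simp: h_def algebra_simps elim!: evenE)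
  ultimately have "h (Suc 0) = h 0"
    using periodic_polynomial_constant[of "k div 2" h m 0] assms(1) by simp
  then show False
    using torus_count_2_less[OF assms(1)] by (simp add: h_def)
qed

theorem theoremF:
  shows "(\<forall>n q :: nat. n \<ge> 1 \<and> even q \<longrightarrow>
            nq_finite_order_le n q 0 (\<lambda>D. int (num_colorings (2 * n) D))) \<and>
         (\<forall>n q :: nat. n \<ge> 2 \<and> even q \<longrightarrow>
            (\<exists>f :: diagram \<Rightarrow> int. nq_finite_order_le n q 0 f \<and> \<not> finite_type f))"
proof (intro conjI allI impI)
  fix n q :: nat
  assume "n \<ge> 2 \<and> even q"
  then have "nq_finite_order_le n q 0 (\<lambda>D. int (num_colorings (2 * n) D))"
    and "\<not> finite_type (\<lambda>D. int (num_colorings (2 * n) D))"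
    using nq_finite_num_colorings[of n q] not_finite_type_num_colorings[of "2 * n"] by auto
  then show "\<exists>f :: diagram \<Rightarrow> int. nq_finite_order_le n q 0 f \<and> \<not> finite_type f"
    by blast
qed (use nq_finite_num_colorings in blast)

end
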